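(* Let $A$ be a commutative unital $C^*$-algebra with unit $I$, let $H$ be a Hilbert $A$-module, and let $\phi:A\to C(X)$ be the Gelfand–Naimark isomorphism, where $X$ is a compact Hausdorff space. Suppose that $\{e_n\}_{n=0}^{\infty}\subseteq H$ is a stationary sequence that generates $H$ and that $\langle e_0,e_0\rangle=I$. Define $\{c_n\}_{n=0}^\infty\subseteq A$ by $c_0=I$ and $c_n=-\sum_{j=0}^{n-1}c_j\langle e_0,e_{n-j}\rangle$ for $n\ge 1$. Then for every $x\in X$, $\{\phi(\langle e_0,e_n\rangle)(x)\}_{n=0}^\infty$ are the non-negative Fourier coefficients of a Borel probability measure on $[0,1)$. Furthermore, the following are equivalent: (1) $\{e_n\}_{n=0}^{\infty}$ is effective. (2) For each $x\in X$, $\{\phi(\langle e_0,e_n\rangle)(x)\}_{n=0}^\infty$ are the non-negative Fourier coefficients of a singular measure or of Lebesgue measure. In particular, if for each $x\in X$ the function $\sum_{n=1}^{\infty}\phi(c_n)(x)z^n$ is an inner function, then $\{e_n\}_{n=0}^{\infty}$ is effective.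
   Context: A Hilbert $A$-module ($A$ a unital $C^*$-algebra) is a complex vector space and left $A$-module $H$ with an inner product $\langle\cdot,\cdot\rangle:H\times H\to A$ such that $\langle x,x\rangle\ge 0$ with equality iff $x=0$, $\langle x,y\rangle=\langle y,x\rangle^*$, and $\langle ax+by,z\rangle=a\langle x,z\rangle+b\langle y,z\rangle$ for $a,b\in A$, and which is complete in the norm $\|x\|=\sqrt{\|\langle x,x\rangle\|_A}$. A sequence $\{e_n\}_{n=0}^\infty$ generates $H$ if the finite $A$-linear combinations of its elements are dense in $H$. It is stationary if there is an $A$-linear isometry $T:H\to H$ with $T^ne_0=e_n$ for all $n$ (such a $T$ is known to preserve the $A$-valued inner product, by a theorem of Blecher; hence $\langle e_n,e_n\rangle=I$ for all $n$ when $\langle e_0,e_0\rangle=I$). A sequence $\{e_n\}_{n=0}^\infty\subseteq H$ with $\langle e_n,e_n\rangle=I$ for all $n$ is called effective if for every $x\in H$ the sequence defined by $x_0=\langle x,e_0\rangle e_0$ and $x_n=x_{n-1}+\langle x-x_{n-1},e_n\rangle e_n$ for $n\ge1$ converges to $x$ in norm. The non-negative Fourier coefficients of a Borel probability measure $\mu$ on $[0,1)$ are $\int_0^1e^{-2\pi i ny}\,d\mu(y)$, $n\ge0$; a singular measure is a Borel probability measure on $[0,1)$ singular with respect to Lebesgue measure. $H^2(\mathbb{D})$ is the Hardy space of functions $\sum_{n\ge0}a_nw^n$ on the unit disk $\mathbb{D}$ with $\sum|a_n|^2<\infty$, with norm $(\sum|a_n|^2)^{1/2}$; an inner function is a bounded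 analytic function $b$ on $\mathbb{D}$ with $\|bf\|_{H^2(\mathbb{D})}=\|f\|_{H^2(\mathbb{D})}$ for all $f\in H^2(\mathbb{D})$. *)

theory Defs
  imports "HOL-Probability.Probability"
begin

section \<open>Complex scalars and unital C*-algebras\<close>

class scaleC =
  fixes scaleC :: "complex \<Rightarrow> 'a \<Rightarrow> 'a" (infixr "*\<^sub>C" 75)

class complex_vector = real_vector + scaleC +
  assumes scaleC_add_right: "z *\<^sub>C (x + y) = z *\<^sub>C x + z *\<^sub>C y"
    and scaleC_add_left: "(z + w) *\<^sub>C x = z *\<^sub>C x + w *\<^sub>C x"
    and scaleC_scaleC: "z *\<^sub>C (w *\<^sub>C x) = (z * w) *\<^sub>C x"
    and scaleC_one: "1 *\<^sub>C x = x"
    and scaleR_eq_scaleC: "r *\<^sub>R x = complex_of_real r *\<^sub>C x"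

class star =
  fixes star :: "'a \<Rightarrow> 'a"

(* Built on real_normed_algebra and monoid_mult instead of real_normed_algebra_1, so that the
   zero algebra (1 = 0) is allowed; if 1 is nonzero, the C*-identity gives norm 1 = 1. *)
class unital_cstar_algebra = real_normed_algebra + monoid_mult + banach + complex_vector + star +
  assumes mult_scaleC_left: "(z *\<^sub>C a) * b = z *\<^sub>C (a * b)"
    and mult_scaleC_right: "a * (z *\<^sub>C b) = z *\<^sub>C (a * b)"
    and norm_scaleC: "norm (z *\<^sub>C a) = cmod z * norm a"
    and star_star: "star (star a) = a"
    and star_add: "star (a + b) = star a + star b"
    and star_scaleC: "star (z *\<^sub>C a) = cnj z *\<^sub>C star a"
    and star_mult: "star (a * b) = star b * star a"
    and cstar_identity: "norm (star a * a) = (norm a)\<^sup>2"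

definition spectrum :: "'a::unital_cstar_algebra \<Rightarrow> complex set" where
  "spectrum a = {z. \<not> (\<exists>b. b * (a - z *\<^sub>C 1) = 1 \<and> (a - z *\<^sub>C 1) * b = 1)}"

definition cstar_nonneg :: "'a::unital_cstar_algebra \<Rightarrow> bool" where
  "cstar_nonneg a \<longleftrightarrow> star a = a \<and> spectrum a \<subseteq> \<real>\<^sub>\<ge>\<^sub>0"

section \<open>Isometric *-isomorphisms onto C(X)\<close>

(* 0 is inserted only for the empty space. *)
definition sup_norm :: "'x topology \<Rightarrow> ('x \<Rightarrow> complex) \<Rightarrow> real" where
  "sup_norm X f = Sup (insert 0 ((\<lambda>x. cmod (f x)) ` topspace X))"

(* Elements of C(X) are represented by functions on the whole type that are continuous on X;
   only their values on topspace X matter, hence equality in C(X) is pointwise on topspace X. *)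
definition cstar_iso_CX ::
    "'x topology \<Rightarrow> ('a::unital_cstar_algebra \<Rightarrow> 'x \<Rightarrow> complex) \<Rightarrow> bool" where
  "cstar_iso_CX X \<phi> \<longleftrightarrow>
     (\<forall>a. continuous_map X euclidean (\<phi> a)) \<and>
     (\<forall>x\<in>topspace X.
        (\<forall>a b. \<phi> (a + b) x = \<phi> a x + \<phi> b x) \<and>
        (\<forall>z a. \<phi> (z *\<^sub>C a) x = z * \<phi> a x) \<and>
        (\<forall>a b. \<phi> (a * b) x = \<phi> a x * \<phi> b x) \<and>
        \<phi> 1 x = 1 \<and>
        (\<forall>a. \<phi> (star a) x = cnj (\<phi> a x))) \<and>
     (\<forall>a b. (\<forall>x\<in>topspace X. \<phi> a x = \<phi> b x) \<longrightarrow> a = b) \<and>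
     (\<forall>f. continuous_map X euclidean f \<longrightarrow> (\<exists>a. \<forall>x\<in>topspace X. \<phi> a x = f x)) \<and>
     (\<forall>a. norm a = sup_norm X (\<phi> a))"

section \<open>Hilbert modules\<close>

(* The type-class norm of 'h is the Hilbert module norm by norm_eq, and completeness in this
   norm is the class banach. *)
locale hilbert_module =
  fixes smul :: "'a::unital_cstar_algebra \<Rightarrow> 'h::{banach, complex_vector} \<Rightarrow> 'h"
    and ip :: "'h \<Rightarrow> 'h \<Rightarrow> 'a"
  assumes smul_add_right: "smul a (x + y) = smul a x + smul a y"
    and smul_add_left: "smul (a + b) x = smul a x + smul b x"
    and smul_smul: "smul a (smul b x) = smul (a * b) x"
    and smul_one: "smul 1 x = x"
    and smul_scaleC_left: "smul (t *\<^sub>C a) x = t *\<^sub>C smul a x"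
    and smul_scaleC_right: "smul a (t *\<^sub>C x) = t *\<^sub>C smul a x"
    and ip_nonneg: "cstar_nonneg (ip x x)"
    and ip_eq_zero_iff: "ip x x = 0 \<longleftrightarrow> x = 0"
    and ip_star: "ip x y = star (ip y x)"
    and ip_linear: "ip (smul a x + smul b y) z = a * ip x z + b * ip y z"
    and norm_eq: "norm x = sqrt (norm (ip x x))"

definition generates ::
    "('a::unital_cstar_algebra \<Rightarrow> 'h::{banach, complex_vector} \<Rightarrow> 'h) \<Rightarrow> (nat \<Rightarrow> 'h) \<Rightarrow> bool" where
  "generates smul e \<longleftrightarrow> closure {y. \<exists>N a. y = (\<Sum>n<N. smul (a n) (e n))} = UNIV"

definition stationary ::
    "('a::unital_cstar_algebra \<Rightarrow> 'h::{banach, complex_vector} \<Rightarrow> 'h) \<Rightarrow> (nat \<Rightarrow> 'h) \<Rightarrow> bool" where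
  "stationary smul e \<longleftrightarrow>
     (\<exists>T. (\<forall>a b x y. T (smul a x + smul b y) = smul a (T x) + smul b (T y)) \<and>
          (\<forall>x. norm (T x) = norm x) \<and>
          (\<forall>n. (T ^^ n) (e 0) = e n))"

primrec effective_approx ::
    "('a::unital_cstar_algebra \<Rightarrow> 'h::{banach, complex_vector} \<Rightarrow> 'h) \<Rightarrow> ('h \<Rightarrow> 'h \<Rightarrow> 'a) \<Rightarrow>
     (nat \<Rightarrow> 'h) \<Rightarrow> 'h \<Rightarrow> nat \<Rightarrow> 'h" where
  "effective_approx smul ip e x 0 = smul (ip x (e 0)) (e 0)"
| "effective_approx smul ip e x (Suc n) =
     effective_approx smul ip e x n +
     smul (ip (x - effective_approx smul ip e x n) (e (Suc n))) (e (Suc n))"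

definition effective ::
    "('a::unital_cstar_algebra \<Rightarrow> 'h::{banach, complex_vector} \<Rightarrow> 'h) \<Rightarrow> ('h \<Rightarrow> 'h \<Rightarrow> 'a) \<Rightarrow>
     (nat \<Rightarrow> 'h) \<Rightarrow> bool" where
  "effective smul ip e \<longleftrightarrow>
     (\<forall>n. ip (e n) (e n) = 1) \<and> (\<forall>x. effective_approx smul ip e x \<longlonglongrightarrow> x)"

section \<open>Measures on [0,1)\<close>

definition prob_measure_01 :: "real measure \<Rightarrow> bool" where
  "prob_measure_01 \<mu> \<longleftrightarrow> prob_space \<mu> \<and> sets \<mu> = sets (restrict_space borel {0..<1})"

definition lebesgue_01 :: "real measure" where
  "lebesgue_01 = restrict_space lborel {0..<1}"

definition mutually_singular :: "'x measure \<Rightarrow> 'x measure \<Rightarrow> bool" where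
  "mutually_singular \<mu> \<nu> \<longleftrightarrow> sets \<mu> = sets \<nu> \<and>
     (\<exists>S\<in>sets \<mu>. emeasure \<mu> (space \<mu> - S) = 0 \<and> emeasure \<nu> S = 0)"

definition singular_measure_01 :: "real measure \<Rightarrow> bool" where
  "singular_measure_01 \<mu> \<longleftrightarrow> prob_measure_01 \<mu> \<and> mutually_singular \<mu> lebesgue_01"

definition fourier_coeff :: "real measure \<Rightarrow> nat \<Rightarrow> complex" where
  "fourier_coeff \<mu> n =
     (\<integral>y. exp (- (2 * complex_of_real pi * \<i> * of_nat n * complex_of_real y)) \<partial>\<mu>)"

section \<open>Hardy space and inner functions\<close>

(* Functions on the unit disk are represented by functions on the complex plane; only their
   values on ball 0 1 matter. *)
definition hardy_H2 :: "(complex \<Rightarrow> complex) set" where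
  "hardy_H2 = {f. \<exists>a. summable (\<lambda>n. (cmod (a n))\<^sup>2) \<and>
                     (\<forall>w\<in>ball 0 1. (\<lambda>n. a n * w ^ n) sums f w)}"

definition power_series_coeffs :: "(complex \<Rightarrow> complex) \<Rightarrow> nat \<Rightarrow> complex" where
  "power_series_coeffs f = (THE a. \<forall>w\<in>ball 0 1. (\<lambda>n. a n * w ^ n) sums f w)"

definition hardy_norm :: "(complex \<Rightarrow> complex) \<Rightarrow> real" where
  "hardy_norm f = sqrt (\<Sum>n. (cmod (power_series_coeffs f n))\<^sup>2)"

definition inner_function :: "(complex \<Rightarrow> complex) \<Rightarrow> bool" where
  "inner_function b \<longleftrightarrow> b holomorphic_on ball 0 1 \<and> bounded (b ` ball 0 1) \<and>
     (\<forall>f\<in>hardy_H2. (\<lambda>w. b w * f w) \<in> hardy_H2 \<and> hardy_norm (\<lambda>w. b w * f w) = hardy_norm f)"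

end

theory Submission
  imports Defs "HOL-Complex_Analysis.Complex_Analysis"
begin

text \<open>
  Evaluating the Gelfand transforms at a point x of X turns the A-valued inner product into a
  positive semidefinite form. By Blecher's theorem, proved here for commutative A
  (isometry_preserves_form), the shift T preserves these forms. So the numbers
  \<gamma>(n) = \<phi> \<langle>e 0, e n\<rangle> x form a positive definite sequence, and Herglotz' theorem (herglotz) represents
  them as the Fourier coefficients of a probability measure \<mu>. At the point x the vectors e n can
  then be replaced by the powers z^n in L^2(\<mu>), where z stands for exp (2 pi i y).

  The errors of the Kaczmarz process have decreasing forms. Hence, by Dini's theorem, the process
  converges in the module norm as soon as it converges at every x (kaczmarz_error_tendsto_0_iff), and
  by linearity it is enough to start it at the generators e k. Effectivity therefore is a question about
  a single measure: does the process with the vectors 1, z, z^2, ... in L^2(\<mu>), started at any power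
  of z, have errors tending to 0? This is the theorem of Kwapien and Mycielski, and it is settled
  in two steps.

  The first step is algebraic. Up to a power of z the process iterates a single operator on functions.
  Comparing its effect on z^(k+1), z^k and z^(-1) shows that all errors tend to 0 if and only if
  either \<gamma>(n) = 0 for all n \<ge> 1, which is the case of Lebesgue measure, or the squares |c(n)|^2 with
  n \<ge> 1 have sum 1, where c is the inverse of \<gamma> for the Cauchy product (residuals_tendsto_0_iff).
  If the power series with the coefficients c(n), n \<ge> 1, is an inner function, then this sum is 1,
  because inner functions have norm 1 in the Hardy space; this gives the last claim directly.

  The second step shows that the sum is 1 if and only if \<mu> is singular. Let F be the power series
  with coefficients \<gamma>(n). Then 1/F has the coefficients c(n), and b = 1 - 1/F maps the disk into
  itself. The Poisson integral P of \<mu> satisfies P = 2 Re F - 1 = (1 - |b|^2) |F|^2, and by Parseval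
  the sum is 1 if and only if the circle means of 1 - |b|^2 tend to 0 at the boundary. For singular \<mu>
  the mass of P concentrates near a null set, while 1 - |b|^2 is bounded by 1 and by 4 P
  (sum_coeffs_eq_1_if_singular). If \<mu> is not singular, then P dominates the Poisson integral of a
  multiple of an indicator function, and as the means of |F|^(1/2) stay bounded, the means of
  1 - |b|^2 cannot tend to 0 (singular_if_sum_coeffs_eq_1). Both arguments stay on
  circles inside the disk, so that no boundary values of b have to be constructed.
\<close>

section \<open>Probability measures on the circle\<close>

definition circ :: "real \<Rightarrow> complex" where "circ y = cis (2 * pi * y)"

lemma norm_circ [simp]: "cmod (circ y) = 1"
  by (simp add: circ_def)

lemma circ_mult_cnj [simp]: "circ y * cnj (circ y) = 1" "cnj (circ y) * circ y = 1"
  by (simp_all add: circ_def cis_cnj cis_mult)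

lemma continuous_on_circ [continuous_intros]: "continuous_on A circ"
  unfolding circ_def by (intro continuous_intros)

lemma circ_power_cnj:
  assumes "m \<le> n" shows "circ y ^ m * cnj (circ y) ^ n = cnj (circ y) ^ (n - m)"
    "circ y ^ n * cnj (circ y) ^ m = circ y ^ (n - m)"
proof -
  have "n = m + (n - m)" using assms by simp
  then have "cnj (circ y) ^ n = cnj (circ y) ^ m * cnj (circ y) ^ (n - m)"
     "circ y ^ n = circ y ^ m * circ y ^ (n - m)" by (metis power_add)+
  then show "circ y ^ m * cnj (circ y) ^ n = cnj (circ y) ^ (n - m)"
     "circ y ^ n * cnj (circ y) ^ m = circ y ^ (n - m)"
    by (simp_all add: power_mult_distrib[symmetric] mult.assoc[symmetric] mult.commute
        mult.left_commute)
qed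

lemma fourier_coeff_circ: "fourier_coeff \<mu> n = (\<integral>y. cnj (circ y) ^ n \<partial>\<mu>)"
proof -
  have "exp (- (2 * complex_of_real pi * \<i> * of_nat n * complex_of_real y)) = cnj (circ y) ^ n" for y
  proof -
    have "cnj (circ y) ^ n = cis (real n * (- (2 * pi * y)))"
      by (simp only: circ_def cis_cnj Complex.DeMoivre)
    then show ?thesis by (simp add: cis_conv_exp mult_ac)
  qed
  then show ?thesis by (simp add: fourier_coeff_def)
qed

lemma prob_measure_01_lebesgue: "prob_measure_01 lebesgue_01"
  unfolding prob_measure_01_def lebesgue_01_def
  by (auto intro!: prob_spaceI simp: emeasure_restrict_space space_restrict_space sets_restrict_space)

locale measure_01 =
  fixes \<mu> :: "real measure"
  assumes prob_01: "prob_measure_01 \<mu>"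
begin

sublocale prob_space \<mu>
  using prob_01 by (simp add: prob_measure_01_def)

lemma sets_01 [measurable_cong]: "sets \<mu> = sets (restrict_space borel {0..<1})"
  using prob_01 by (simp add: prob_measure_01_def)

lemma space_01: "space \<mu> = {0..<1}"
  using sets_eq_imp_space_eq[OF sets_01] by (simp add: space_restrict_space)

lemma measurable_01_continuous:
  fixes f :: "real \<Rightarrow> 'b::{second_countable_topology, t2_space}"
  assumes "continuous_on UNIV f" shows "f \<in> borel_measurable \<mu>"
proof -
  have "f \<in> borel_measurable (restrict_space borel {0..<1})"
    by (intro measurable_restrict_space1 borel_measurable_continuous_onI assms)
  then show ?thesis by (simp add: measurable_cong_sets[OF sets_01])
qed

lemma integrable_01_bounded:
  fixes f :: "real \<Rightarrow> 'b::{banach, second_countable_topology}"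
  assumes "f \<in> borel_measurable \<mu>" "\<And>y. 0 \<le> y \<Longrightarrow> y < 1 \<Longrightarrow> norm (f y) \<le> B"
  shows "integrable \<mu> f"
  using assms by (intro integrable_const_bound[where B=B]) (auto simp: space_01)

lemma integrable_01:
  fixes f :: "real \<Rightarrow> 'b::{banach, second_countable_topology}"
  assumes "continuous_on UNIV f"
  shows "integrable \<mu> f"
proof -
  have "compact (f ` {0..1})"
    by (intro compact_continuous_image continuous_on_subset[OF assms]) auto
  then obtain B where "\<forall>x\<in>f ` {0..1}. norm x \<le> B"
    using compact_imp_bounded bounded_iff by blast
  then show ?thesis
    by (intro integrable_01_bounded measurable_01_continuous assms) auto
qed

lemma fourier_coeff_0: "fourier_coeff \<mu> 0 = 1"
  by (simp add: fourier_coeff_circ prob_space)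

lemma integral_circ_power: "(\<integral>y. circ y ^ n \<partial>\<mu>) = cnj (fourier_coeff \<mu> n)"
  unfolding fourier_coeff_circ by (subst Bochner_Integration.integral_cnj[symmetric]) simp

section \<open>The Kaczmarz process in a space of functions on the circle\<close>

text \<open>
  In L^2(\<mu>), the step of the Kaczmarz process with the vector z^n replaces the current error
  w by w - \<langle>w, z^n\<rangle> z^n. If w = z^n f, the new error is z^(n+1) times the
  function defined here. So all steps of the process are iterations of one operator: the
  projection onto the orthogonal complement of the constants, followed by division by z.
\<close>

definition bshift :: "(real \<Rightarrow> complex) \<Rightarrow> real \<Rightarrow> complex" where
  "bshift f = (\<lambda>y. cnj (circ y) * (f y - (\<integral>t. f t \<partial>\<mu>)))"

lemma continuous_on_bshift: "continuous_on UNIV f \<Longrightarrow> continuous_on UNIV (bshift f)"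
  unfolding bshift_def by (intro continuous_intros)

lemma continuous_on_bshift_iter: "continuous_on UNIV f \<Longrightarrow> continuous_on UNIV ((bshift ^^ n) f)"
  by (induction n) (auto intro: continuous_on_bshift)

text \<open>
  Pythagoras: multiplication with a unimodular function preserves the norm, and the constant
  function 1 is a unit vector.
\<close>

lemma integral_norm_bshift:
  assumes f: "continuous_on UNIV f"
  shows "(\<integral>y. (cmod (bshift f y))\<^sup>2 \<partial>\<mu>) = (\<integral>y. (cmod (f y))\<^sup>2 \<partial>\<mu>) - (cmod (\<integral>y. f y \<partial>\<mu>))\<^sup>2"
proof -
  define a where "a = (\<integral>y. f y \<partial>\<mu>)"
  have 1: "integrable \<mu> f" "integrable \<mu> (\<lambda>y. f y * cnj a)" "integrable \<mu> (\<lambda>y. (cmod (f y))\<^sup>2)"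
    by (intro integrable_01 continuous_intros f)+
  have "(cmod (bshift f y))\<^sup>2 = (cmod (f y))\<^sup>2 - 2 * Re (f y * cnj a) + (cmod a)\<^sup>2" for y
  proof -
    have "cmod (bshift f y) = cmod (f y - a)"
      by (simp add: bshift_def norm_mult a_def)
    then show ?thesis by (simp add: cmod_power2 power2_diff algebra_simps)
  qed
  then have "(\<integral>y. (cmod (bshift f y))\<^sup>2 \<partial>\<mu>) =
     (\<integral>y. (cmod (f y))\<^sup>2 \<partial>\<mu>) - 2 * (\<integral>y. Re (f y * cnj a) \<partial>\<mu>) + (cmod a)\<^sup>2"
    using 1 by (simp add: prob_space)
  also have "(\<integral>y. Re (f y * cnj a) \<partial>\<mu>) = Re (a * cnj a)"
    using 1 by (subst integral_Re) (auto simp: a_def)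
  also have "\<dots> = (cmod a)\<^sup>2"
    unfolding cmod_power2 by (simp add: power2_eq_square)
  finally show ?thesis by (simp add: a_def)
qed

lemma bshift_diff:
  assumes "continuous_on UNIV f" "continuous_on UNIV g"
  shows "bshift (\<lambda>y. f y - a * g y) = (\<lambda>y. bshift f y - a * bshift g y)"
  using integrable_01[OF assms(1)] integrable_01[OF assms(2)]
  by (auto simp: bshift_def algebra_simps)

lemma bshift_iter_diff:
  assumes "continuous_on UNIV f" "continuous_on UNIV g"
  shows "(bshift ^^ n) (\<lambda>y. f y - a * g y) = (\<lambda>y. (bshift ^^ n) f y - a * (bshift ^^ n) g y)"
  using assms by (induction n) (simp_all add: bshift_diff continuous_on_bshift_iter)

definition residual :: "(real \<Rightarrow> complex) \<Rightarrow> nat \<Rightarrow> real" where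
  "residual f n = (\<integral>y. (cmod ((bshift ^^ n) f y))\<^sup>2 \<partial>\<mu>)"

lemma residual_nonneg: "residual f n \<ge> 0"
  by (simp add: residual_def)

lemma residual_Suc:
  "continuous_on UNIV f \<Longrightarrow>
     residual f (Suc n) = residual f n - (cmod (\<integral>y. (bshift ^^ n) f y \<partial>\<mu>))\<^sup>2"
  by (simp add: residual_def integral_norm_bshift continuous_on_bshift_iter)

lemma residual_shift: "residual f (Suc n) = residual (bshift f) n"
  by (simp only: residual_def funpow_Suc_right o_apply)

text \<open>
  The crude triangle inequality for the square of the seminorm on functions that the iteration
  defines. The constant 2 is harmless, since only convergence to 0 is at stake.
\<close>

lemma residual_diff_le:
  assumes f: "continuous_on UNIV f" and g: "continuous_on UNIV g"
  shows "residual (\<lambda>y. f y - a * g y) n \<le> 2 * residual f n + 2 * (cmod a)\<^sup>2 * residual g n"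
proof -
  define F G where "F = (bshift ^^ n) f" and "G = (bshift ^^ n) g"
  have c: "continuous_on UNIV F" "continuous_on UNIV G"
    using f g by (auto simp: F_def G_def continuous_on_bshift_iter)
  have "(cmod (F y - a * G y))\<^sup>2 \<le> 2 * (cmod (F y))\<^sup>2 + 2 * (cmod a)\<^sup>2 * (cmod (G y))\<^sup>2" for y
  proof -
    have "(cmod (F y - a * G y))\<^sup>2 \<le> (cmod (F y) + cmod a * cmod (G y))\<^sup>2"
      by (metis norm_mult norm_triangle_ineq4 norm_ge_zero power_mono)
    also have "\<dots> \<le> 2 * (cmod (F y))\<^sup>2 + 2 * (cmod a)\<^sup>2 * (cmod (G y))\<^sup>2"
      using sum_squares_ge_zero[of "cmod (F y) - cmod a * cmod (G y)" 0]
      by (simp add: power2_sum power2_diff power_mult_distrib power2_eq_square algebra_simps)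
    finally show ?thesis .
  qed
  then have "residual (\<lambda>y. f y - a * g y) n \<le> (\<integral>y. 2 * (cmod (F y))\<^sup>2 + 2 * (cmod a)\<^sup>2
      * (cmod (G y))\<^sup>2 \<partial>\<mu>)"
    unfolding residual_def bshift_iter_diff[OF f g] F_def[symmetric] G_def[symmetric]
    by (intro integral_mono integrable_01 continuous_intros c) auto
  also have "\<dots> = 2 * (\<integral>y. (cmod (F y))\<^sup>2 \<partial>\<mu>) + 2 * (cmod a)\<^sup>2 * (\<integral>y. (cmod (G y))\<^sup>2 \<partial>\<mu>)"
    by (subst Bochner_Integration.integral_add)
       (auto intro!: integrable_01 continuous_intros c)
  finally show ?thesis by (simp add: residual_def F_def G_def)
qed

lemma bshift_iter_zero: "(bshift ^^ n) (\<lambda>y. 0) = (\<lambda>y. 0)"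
  by (induction n) (auto simp: bshift_def)

lemma bshift_one: "bshift (\<lambda>y. 1) = (\<lambda>y. 0)"
  by (simp add: bshift_def prob_space)

text \<open>
  The power z^(k+1) loses one factor z, and the price is a multiple of the inverse of z. This
  recursion reduces the Kaczmarz process started at any power of z to the one started at z^(-1).
\<close>

lemma bshift_circ_power:
  "bshift (\<lambda>y. circ y ^ Suc k) = (\<lambda>y. circ y ^ k - cnj (fourier_coeff \<mu> (Suc k)) * cnj (circ y))"
proof
  fix y
  have "cnj (circ y) * circ y ^ Suc k = circ y ^ k"
    by (simp add: mult.assoc[symmetric])
  then show "bshift (\<lambda>y. circ y ^ Suc k) y = circ y ^ k - cnj (fourier_coeff \<mu> (Suc k)) * cnj (circ y)"
    unfolding bshift_def integral_circ_power by (simp add: algebra_simps)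
qed

end

text \<open>
  For \<gamma> 0 = 1 this determines c as the inverse of \<gamma> for the Cauchy product.
\<close>

definition inverse_coeffs :: "(nat \<Rightarrow> complex) \<Rightarrow> (nat \<Rightarrow> complex) \<Rightarrow> bool" where
  "inverse_coeffs \<gamma> c \<longleftrightarrow> c 0 = 1 \<and> (\<forall>n. c (Suc n) = - (\<Sum>j\<le>n. c j * \<gamma> (Suc n - j)))"

context measure_01 begin

context
  fixes c :: "nat \<Rightarrow> complex"
  assumes c: "inverse_coeffs (fourier_coeff \<mu>) c"
begin

lemma integral_inverse_coeffs:
  "(\<integral>t. (\<Sum>j\<le>n. c j * cnj (circ t) ^ (Suc n - j)) \<partial>\<mu>) = - c (Suc n)"
proof -
  have "(\<integral>t. (\<Sum>j\<le>n. c j * cnj (circ t) ^ (Suc n - j)) \<partial>\<mu>)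
      = (\<Sum>j\<le>n. c j * fourier_coeff \<mu> (Suc n - j))"
    unfolding fourier_coeff_circ
    by (subst Bochner_Integration.integral_sum)
       (auto intro!: integrable_01 continuous_intros sum.cong)
  then show ?thesis using c by (simp add: inverse_coeffs_def)
qed

lemma bshift_iter_cnj_circ:
  "(bshift ^^ n) (\<lambda>y. cnj (circ y)) = (\<lambda>y. \<Sum>j\<le>n. c j * cnj (circ y) ^ (Suc n - j))"
proof (induction n)
  case 0
  show ?case using c by (simp add: inverse_coeffs_def)
next
  case (Suc n)
  show ?case
  proof
    fix y
    have "(bshift ^^ Suc n) (\<lambda>y. cnj (circ y)) y =
       cnj (circ y) * ((\<Sum>j\<le>n. c j * cnj (circ y) ^ (Suc n - j)) + c (Suc n))"
      by (simp add: Suc bshift_def integral_inverse_coeffs del: sum.atMost_Suc)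
    also have "\<dots> = (\<Sum>j\<le>n. c j * (cnj (circ y) * cnj (circ y) ^ (Suc n - j))) + c (Suc n) * cnj (circ y)"
      by (simp add: algebra_simps sum_distrib_left)
    also have "(\<Sum>j\<le>n. c j * (cnj (circ y) * cnj (circ y) ^ (Suc n - j)))
        = (\<Sum>j\<le>n. c j * cnj (circ y) ^ (Suc (Suc n) - j))"
      by (intro sum.cong refl) (simp add: Suc_diff_le)
    finally show "(bshift ^^ Suc n) (\<lambda>y. cnj (circ y)) y
        = (\<Sum>j\<le>Suc n. c j * cnj (circ y) ^ (Suc (Suc n) - j))"
      by simp
  qed
qed

text \<open>
  Started at z^(-1), the iteration can be followed explicitly: the coefficients that appear are
  the c(j), and the part removed in step n has norm |c(n+1)|.
\<close>

lemma residual_cnj_circ: "residual (\<lambda>y. cnj (circ y)) n = 1 - (\<Sum>j<n. (cmod (c (Suc j)))\<^sup>2)"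
proof (induction n)
  case 0
  show ?case by (simp add: residual_def prob_space)
next
  case (Suc n)
  have "cmod (\<integral>t. (bshift ^^ n) (\<lambda>y. cnj (circ y)) t \<partial>\<mu>) = cmod (c (Suc n))"
    by (simp add: bshift_iter_cnj_circ integral_inverse_coeffs)
  then show ?case
    using Suc by (subst residual_Suc) (auto intro!: continuous_intros)
qed

lemma sum_coeffs_le: "(\<Sum>j<n. (cmod (c (Suc j)))\<^sup>2) \<le> 1"
  using residual_cnj_circ[of n] residual_nonneg[of "\<lambda>y. cnj (circ y)" n] by simp

text \<open>
  The limiting seminorm L of the iteration vanishes at 1, and L(z^(k+1)) is L evaluated at z^k
  minus the conjugate of \<gamma>(k+1) times z^(-1). If L(z^(-1)) = 0, induction on k kills
  every power. If all powers are killed, then |\<gamma>(k+1)| L(z^(-1)) = 0 for all k. Finally,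
  L(z^(-1)) = 0 says that the squares |c(n)|^2 with n \<ge> 1 sum up to 1.
\<close>

theorem residuals_tendsto_0_iff:
  "(\<forall>k. residual (\<lambda>y. circ y ^ k) \<longlonglongrightarrow> 0) \<longleftrightarrow>
     (\<forall>k. fourier_coeff \<mu> (Suc k) = 0) \<or> (\<lambda>n. (cmod (c (Suc n)))\<^sup>2) sums 1"
proof -
  define R where "R = residual (\<lambda>y. cnj (circ y))"
  define Q where "Q k = residual (\<lambda>y. circ y ^ k)" for k
  define g where "g k = cnj (fourier_coeff \<mu> (Suc k))" for k
  have cont: "continuous_on UNIV (\<lambda>y. circ y ^ k)" "continuous_on UNIV (\<lambda>y. cnj (circ y))" for k
    by (intro continuous_intros)+
  have R0: "0 \<le> R n" for n by (simp add: R_def residual_nonneg)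
  have R: "(\<lambda>n. (cmod (c (Suc n)))\<^sup>2) sums 1 \<longleftrightarrow> R \<longlonglongrightarrow> 0"
  proof -
    have "R = (\<lambda>n. 1 - (\<Sum>j<n. (cmod (c (Suc j)))\<^sup>2))"
      by (simp add: R_def residual_cnj_circ fun_eq_iff)
    then have "R \<longlonglongrightarrow> 0 \<longleftrightarrow> (\<lambda>n. 1 - (\<Sum>j<n. (cmod (c (Suc j)))\<^sup>2)) \<longlonglongrightarrow> 1 - 1" by simp
    also have "\<dots> \<longleftrightarrow> (\<lambda>n. (\<Sum>j<n. (cmod (c (Suc j)))\<^sup>2)) \<longlonglongrightarrow> 1"
      using tendsto_diff[OF tendsto_const[of 1], of "\<lambda>n. 1 - (\<Sum>j<n. (cmod (c (Suc j)))\<^sup>2)" "0::real"]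
        tendsto_diff[OF tendsto_const[of 1], of "\<lambda>n. (\<Sum>j<n. (cmod (c (Suc j)))\<^sup>2)" "1::real"]
      by auto
    finally show ?thesis by (simp add: sums_def)
  qed
  have Q0: "Q 0 n = 0" if "n > 0" for n
  proof -
    obtain m where "n = Suc m" using \<open>n > 0\<close> gr0_implies_Suc by blast
    then show ?thesis
      by (simp only: Q_def power_0 residual_shift bshift_one) (simp add: residual_def bshift_iter_zero)
  qed
  have step: "Q (Suc k) (Suc n) = residual (\<lambda>y. circ y ^ k - g k * cnj (circ y)) n" for k n
    unfolding Q_def residual_shift bshift_circ_power g_def ..
  \<comment> \<open>Both inequalities come from the recursion for the powers of z; the first drives the induction
     on k, the second isolates the contribution of the inverse of z.\<close>
  have up: "Q (Suc k) (Suc n) \<le> 2 * Q k n + 2 * ((cmod (g k))\<^sup>2 * R n)" for k n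
    unfolding step using residual_diff_le[OF cont, of k "g k" n]  by (simp add: R_def Q_def)
  have dn: "(cmod (g k))\<^sup>2 * R n \<le> 2 * Q k n + 2 * Q (Suc k) (Suc n)" for k n
  proof -
    have c2: "continuous_on UNIV (\<lambda>y. circ y ^ k - g k * cnj (circ y))" by (intro continuous_intros)
    have eq: "(\<lambda>y. circ y ^ k - 1 * (circ y ^ k - g k * cnj (circ y)))
        = (\<lambda>y. 0 - (- g k) * cnj (circ y))" by auto
    have "residual (\<lambda>y. 0 - (- g k) * cnj (circ y)) n = (cmod (g k))\<^sup>2 * R n"
      unfolding residual_def by (subst bshift_iter_diff)
        (auto simp: bshift_iter_zero R_def residual_def norm_mult power_mult_distrib intro!: cont)
    then show ?thesis
      using residual_diff_le[OF cont(1) c2, of k 1 n] unfolding eq step by (simp add: Q_def)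
  qed
  show ?thesis
  proof
    assume *: "\<forall>k. residual (\<lambda>y. circ y ^ k) \<longlonglongrightarrow> 0"
    show "(\<forall>k. fourier_coeff \<mu> (Suc k) = 0) \<or> (\<lambda>n. (cmod (c (Suc n)))\<^sup>2) sums 1"
    proof (rule disjCI)
      assume "\<not> (\<lambda>n. (cmod (c (Suc n)))\<^sup>2) sums 1"
      then have nR: "\<not> R \<longlonglongrightarrow> 0" using R by simp
      show "\<forall>k. fourier_coeff \<mu> (Suc k) = 0"
      proof (rule ccontr)
        assume "\<not> ?thesis"
        then obtain k where k: "g k \<noteq> 0" by (auto simp: g_def)
        have "Q k \<longlonglongrightarrow> 0" "(\<lambda>n. Q (Suc k) (Suc n)) \<longlonglongrightarrow> 0"
          using * LIMSEQ_Suc by (auto simp: Q_def simp del: power_Suc)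
        then have "(\<lambda>n. 2 * Q k n + 2 * Q (Suc k) (Suc n)) \<longlonglongrightarrow> 2 * 0 + 2 * 0"
          by (intro tendsto_intros)
        then have "(\<lambda>n. (cmod (g k))\<^sup>2 * R n) \<longlonglongrightarrow> 0"
          by (intro tendsto_sandwich[of "\<lambda>n. 0" "\<lambda>n. (cmod (g k))\<^sup>2 * R n" sequentially "\<lambda>n. 2
              * Q k n + 2 * Q (Suc k) (Suc n)"])
             (auto simp: dn R0)
        then have "R \<longlonglongrightarrow> 0" using k by (simp add: tendsto_mult_left_iff)
        with nR show False by simp
      qed
    qed
  next
    assume "(\<forall>k. fourier_coeff \<mu> (Suc k) = 0) \<or> (\<lambda>n. (cmod (c (Suc n)))\<^sup>2) sums 1"
    then have gR: "(\<lambda>n. (cmod (g k))\<^sup>2 * R n) \<longlonglongrightarrow> 0" for k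
      using R by (auto simp: g_def intro: tendsto_mult_right_zero)
    have "Q k \<longlonglongrightarrow> 0" for k
    proof (induction k)
      case 0
      show ?case
        by (rule tendsto_eventually) (use Q0 in \<open>auto simp: eventually_sequentially intro!: exI[of _
            1]\<close>)
    next
      case (Suc k)
      have "(\<lambda>n. 2 * Q k n + 2 * ((cmod (g k))\<^sup>2 * R n)) \<longlonglongrightarrow> 2 * 0 + 2 * 0"
        by (intro tendsto_intros Suc gR)
      then have "(\<lambda>n. Q (Suc k) (Suc n)) \<longlonglongrightarrow> 0"
        by (intro tendsto_sandwich[of "\<lambda>n. 0" "\<lambda>n. Q (Suc k) (Suc n)" sequentially "\<lambda>n. 2 * Q k n
            + 2 * ((cmod (g k))\<^sup>2 * R n)"])
           (auto simp: up, simp add: Q_def residual_nonneg)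
      then show ?case by (rule LIMSEQ_imp_Suc)
    qed
    then show "\<forall>k. residual (\<lambda>y. circ y ^ k) \<longlonglongrightarrow> 0" by (simp add: Q_def)
  qed
qed

end

end

section \<open>Power series on circles and the Poisson kernel\<close>

interpretation leb: measure_01 lebesgue_01
  by standard (rule prob_measure_01_lebesgue)

lemma fourier_coeff_lebesgue: "fourier_coeff lebesgue_01 n = (if n = 0 then 1 else 0)"
proof (cases "n = 0")
  case False
  define f where "f y = cnj (circ y) ^ n" for y
  define k where "k = - (2 * complex_of_real pi * \<i> * of_nat n)"
  define F where "F y = f y / k" for y
  have k: "k \<noteq> 0" using False by (simp add: k_def)
  have f_exp: "f y = exp (k * of_real y)" for y
  proof -
    have "f y = cis (real n * (- (2 * pi * y)))"
      by (simp only: f_def circ_def cis_cnj Complex.DeMoivre)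
    then show ?thesis by (simp add: cis_conv_exp k_def mult_ac)
  qed
  have deriv: "(F has_vector_derivative f y) (at y within {0..1})" for y
  proof -
    have "((\<lambda>z. exp (k * z) / k) has_field_derivative exp (k * of_real y)) (at (of_real y))"
      using k by (auto intro!: derivative_eq_intros)
    then show ?thesis
      unfolding F_def f_exp by (rule has_vector_derivative_real_field[unfolded o_def])
  qed
  have cont: "continuous_on {0..1} f"
    unfolding f_def by (intro continuous_intros)
  have "fourier_coeff lebesgue_01 n = (\<integral>y. indicator {0..<1} y *\<^sub>R f y \<partial>lborel)"
    unfolding fourier_coeff_circ lebesgue_01_def f_def[symmetric]
    by (subst integral_restrict_space) auto
  also have "\<dots> = (\<integral>y. indicator {0..1} y *\<^sub>R f y \<partial>lborel)"
  proof (rule integral_cong_AE)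
    have [measurable]: "f \<in> borel_measurable borel"
      unfolding f_def by (intro borel_measurable_continuous_onI continuous_intros)
    show "(\<lambda>y. indicator {0..<1} y *\<^sub>R f y) \<in> borel_measurable lborel"
      "(\<lambda>y. indicator {0..1} y *\<^sub>R f y) \<in> borel_measurable lborel" by measurable
    show "AE y in lborel. indicator {0..<1} y *\<^sub>R f y = indicator {0..1} y *\<^sub>R f y"
      using AE_lborel_singleton[of "1::real"] by eventually_elim (auto simp: indicator_def)
  qed
  also have "\<dots> = F 1 - F 0"
    by (rule integral_FTC_Icc[OF _ deriv cont]) auto
  also have "\<dots> = 0"
    by (simp add: F_def f_def circ_def)
  finally show ?thesis using False by simp
qed (simp add: leb.fourier_coeff_0)

lemma lebesgue_orthonormal:
  "(\<integral>t. circ t ^ m * cnj (circ t) ^ n \<partial>lebesgue_01) = (if m = n then 1 else 0)"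
proof (cases "m \<le> n")
  case True
  then show ?thesis
    by (auto simp: circ_power_cnj fourier_coeff_lebesgue simp flip: fourier_coeff_circ)
next
  case False
  then show ?thesis
    by (auto simp: circ_power_cnj leb.integral_circ_power fourier_coeff_lebesgue)
qed

context measure_01 begin

lemma integral_series:
  fixes a :: "nat \<Rightarrow> complex"
  assumes "summable (\<lambda>n. cmod (a n))"
    and "\<And>n. f n \<in> borel_measurable \<mu>" and f: "\<And>n y. cmod (f n y) \<le> B"
  shows "(\<lambda>n. a n * (\<integral>y. f n y \<partial>\<mu>)) sums (\<integral>y. (\<Sum>n. a n * f n y) \<partial>\<mu>)"
proof -
  have B: "0 \<le> B" using f[of 0 0] norm_ge_zero order_trans by blast
  have int: "integrable \<mu> (f n)" for n
    using assms by (intro integrable_const_bound[where B=B]) auto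
  have "(\<lambda>n. \<integral>y. a n * f n y \<partial>\<mu>) sums (\<integral>y. (\<Sum>n. a n * f n y) \<partial>\<mu>)"
  proof (rule sums_integral)
    show "integrable \<mu> (\<lambda>y. a n * f n y)" for n using int by simp
    have "summable (\<lambda>n. cmod (a n * f n y))" for y
      by (rule summable_comparison_test'[OF summable_mult2[OF assms(1), of B]])
         (simp add: norm_mult mult_left_mono f)
    then show "AE y in \<mu>. summable (\<lambda>n. cmod (a n * f n y))" by simp
    have "(\<integral>y. cmod (a n * f n y) \<partial>\<mu>) \<le> cmod (a n) * B" for n
    proof -
      have "(\<integral>y. cmod (a n * f n y) \<partial>\<mu>) \<le> (\<integral>y. cmod (a n) * B \<partial>\<mu>)"
        using int by (intro integral_mono) (auto simp: norm_mult mult_left_mono f)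
      then show ?thesis by (simp add: prob_space)
    qed
    then show "summable (\<lambda>n. \<integral>y. cmod (a n * f n y) \<partial>\<mu>)"
      by (intro summable_comparison_test'[OF summable_mult2[OF assms(1), of B]])
         (auto simp: integral_nonneg_AE)
  qed
  then show ?thesis by simp
qed

end

lemma summable_cmod_powser:
  assumes "summable (\<lambda>n. cmod (d n) * r ^ n)" "0 \<le> r"
  shows "summable (\<lambda>n. cmod (d n * (of_real r * circ t) ^ n))"
  using assms by (simp add: norm_mult norm_power)

text \<open>
  Cauchy's coefficient formula, read off by integrating the series term by term.
\<close>

lemma circle_coefficient:
  assumes d: "summable (\<lambda>n. cmod (d n) * r ^ n)" and r: "0 \<le> r"
  shows "(\<integral>t. (\<Sum>n. d n * (of_real r * circ t) ^ n) * cnj (circ t) ^ m \<partial>lebesgue_01)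
      = d m * of_real r ^ m"
proof -
  have eq: "(\<Sum>n. d n * (of_real r * circ t) ^ n) * cnj (circ t) ^ m
     = (\<Sum>n. (d n * of_real r ^ n) * (circ t ^ n * cnj (circ t) ^ m))" for t
    using summable_mult2[OF summable_norm_cancel[OF summable_cmod_powser[OF d r]]]
    by (subst suminf_mult2) (auto simp: summable_norm_cancel[OF summable_cmod_powser[OF d r]]
        power_mult_distrib mult_ac)
  have "(\<lambda>n. (d n * of_real r ^ n) * (\<integral>t. circ t ^ n * cnj (circ t) ^ m \<partial>lebesgue_01)) sums
     (\<integral>t. (\<Sum>n. (d n * of_real r ^ n) * (circ t ^ n * cnj (circ t) ^ m)) \<partial>lebesgue_01)"
    using d r by (intro leb.integral_series[where B=1])
       (auto simp: norm_mult norm_power intro!: leb.measurable_01_continuous continuous_intros)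
  moreover have "(\<lambda>n. (d n * of_real r ^ n) * (\<integral>t. circ t ^ n * cnj (circ t) ^ m \<partial>lebesgue_01))
      sums (d m * of_real r ^ m)"
    unfolding lebesgue_orthonormal using sums_single[of m "\<lambda>n. d n * of_real r ^ n"]
    by (rule back_subst[where P="\<lambda>f. f sums _"]) auto
  ultimately show ?thesis unfolding eq using sums_unique2 by blast
qed

lemma circle_mean:
  assumes d: "summable (\<lambda>n. cmod (d n) * r ^ n)" and r: "0 \<le> r"
  shows "(\<integral>t. (\<Sum>n. d n * (of_real r * circ t) ^ n) \<partial>lebesgue_01) = d 0"
  using circle_coefficient[OF assms, of 0] by simp

lemma circle_parseval:
  assumes d: "summable (\<lambda>n. cmod (d n) * r ^ n)" and r: "0 \<le> r"
  shows "(\<lambda>n. (cmod (d n))\<^sup>2 * r ^ (2 * n)) sums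
     (\<integral>t. (cmod (\<Sum>n. d n * (of_real r * circ t) ^ n))\<^sup>2 \<partial>lebesgue_01)"
proof -
  define f where "f t = (\<Sum>n. d n * (of_real r * circ t) ^ n)" for t
  note s = summable_cmod_powser[OF d r]
  have [measurable]: "circ \<in> borel_measurable lebesgue_01"
    by (intro leb.measurable_01_continuous continuous_intros)
  have [measurable]: "(\<lambda>t. cnj (circ t) ^ n) \<in> borel_measurable lebesgue_01" for n
    by (intro leb.measurable_01_continuous continuous_intros)
  have [measurable]: "f \<in> borel_measurable lebesgue_01"
    unfolding f_def by measurable
  have bound: "cmod (f t) \<le> (\<Sum>n. cmod (d n) * r ^ n)" for t
    using summable_norm[OF s] r by (simp add: f_def norm_mult norm_power)
  have eq: "of_real ((cmod (f t))\<^sup>2) = (\<Sum>n. cnj (d n) * of_real r ^ n * (f t * cnj (circ t) ^ n))" for t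
  proof -
    have "of_real ((cmod (f t))\<^sup>2) = f t * cnj (f t)"
      by (rule complex_norm_square)
    also have "\<dots> = (\<Sum>n. f t * cnj (d n * (of_real r * circ t) ^ n))"
      unfolding f_def
      by (intro sums_unique sums_mult iffD2[OF sums_cnj] summable_sums summable_norm_cancel[OF s])
    finally show ?thesis by (simp add: power_mult_distrib mult_ac)
  qed
  have "(\<lambda>n. (cnj (d n) * of_real r ^ n) * (\<integral>t. f t * cnj (circ t) ^ n \<partial>lebesgue_01)) sums
     (\<integral>t. (\<Sum>n. (cnj (d n) * of_real r ^ n) * (f t * cnj (circ t) ^ n)) \<partial>lebesgue_01)"
    using d r by (intro leb.integral_series[where B="\<Sum>n. cmod (d n) * r ^ n"])
       (auto simp: norm_mult norm_power bound intro!: borel_measurable_times)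
  also have "(\<integral>t. (\<Sum>n. (cnj (d n) * of_real r ^ n) * (f t * cnj (circ t) ^ n)) \<partial>lebesgue_01) =
     of_real (\<integral>t. (cmod (f t))\<^sup>2 \<partial>lebesgue_01)"
    unfolding eq[symmetric] by (rule integral_complex_of_real)
  also have "(\<lambda>n. (cnj (d n) * of_real r ^ n) * (\<integral>t. f t * cnj (circ t) ^ n \<partial>lebesgue_01)) =
     (\<lambda>n. of_real ((cmod (d n))\<^sup>2 * r ^ (2 * n)))"
  proof
    fix n
    have "complex_of_real ((cmod (d n))\<^sup>2 * r ^ (2 * n))
        = complex_of_real ((cmod (d n))\<^sup>2) * of_real (r ^ n * r ^ n)"
      by (simp add: mult_2 power_add)
    also have "\<dots> = d n * cnj (d n) * of_real (r ^ n * r ^ n)"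
      by (simp only: complex_norm_square)
    finally show "(cnj (d n) * of_real r ^ n) * (\<integral>t. f t * cnj (circ t) ^ n \<partial>lebesgue_01)
        = of_real ((cmod (d n))\<^sup>2 * r ^ (2 * n))"
      unfolding f_def circle_coefficient[OF d r] by simp
  qed
  finally show ?thesis unfolding sums_of_real_iff f_def .
qed

text \<open>
  The mean value property, applied below to the square root of a function in the right
  half-plane.
\<close>

lemma circle_mean_holomorphic:
  assumes f: "f holomorphic_on ball 0 1" and r: "0 \<le> r" "r < 1"
  shows "(\<integral>t. f (of_real r * circ t) \<partial>lebesgue_01) = f 0"
proof -
  define d where "d n = (deriv ^^ n) f 0 / fact n" for n
  have d: "(\<lambda>n. d n * w ^ n) sums f w" if "cmod w < 1" for w
    using holomorphic_power_series[OF f, of w] that by (simp add: d_def)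
  define r' where "r' = (r + 1) / 2"
  have r': "r < r'" "r' < 1" using r by (auto simp: r'_def)
  have "summable (\<lambda>n. cmod (d n * of_real r ^ n))"
    by (rule powser_insidea[OF sums_summable[OF d, of "of_real r'"]]) (use r r' in auto)
  then have s: "summable (\<lambda>n. cmod (d n) * r ^ n)"
    using r by (simp add: norm_mult norm_power)
  have "(\<integral>t. f (of_real r * circ t) \<partial>lebesgue_01)
      = (\<integral>t. (\<Sum>n. d n * (of_real r * circ t) ^ n) \<partial>lebesgue_01)"
    by (intro Bochner_Integration.integral_cong refl sums_unique d) (use r in \<open>simp add: norm_mult\<close>)
  also have "\<dots> = f 0" using circle_mean[OF s r(1)] by (simp add: d_def)
  finally show ?thesis .
qed

text \<open>
  The Poisson kernel of the disk at the point w and the boundary point with angle 2 pi y.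
\<close>

definition poisson :: "complex \<Rightarrow> real \<Rightarrow> real" where
  "poisson w y = (1 - (cmod w)\<^sup>2) / (cmod (1 - w * cnj (circ y)))\<^sup>2"

lemma poisson_denominator_pos:
  assumes "cmod w < 1" shows "0 < cmod (1 - w * cnj (circ y))" "1 - cmod w
      \<le> cmod (1 - w * cnj (circ y))"
proof -
  show "1 - cmod w \<le> cmod (1 - w * cnj (circ y))"
    using norm_triangle_ineq2[of 1 "w * cnj (circ y)"] by (simp add: norm_mult)
  then show "0 < cmod (1 - w * cnj (circ y))" using assms by linarith
qed

lemma poisson_nonneg: "cmod w < 1 \<Longrightarrow> 0 \<le> poisson w y"
  by (simp add: poisson_def power_le_one)

lemma poisson_le:
  assumes "cmod w < 1" shows "poisson w y \<le> 1 / (1 - cmod w)\<^sup>2"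
  unfolding poisson_def using assms poisson_denominator_pos[OF assms]
  by (intro frac_le power_mono) auto

lemma poisson_series:
  assumes "cmod w < 1"
  shows "poisson w y = 2 * Re (\<Sum>n. (w * cnj (circ y)) ^ n) - 1"
proof -
  define z where "z = w * cnj (circ y)"
  have z: "cmod z = cmod w" "cmod z < 1" using assms by (simp_all add: z_def norm_mult)
  have nz: "1 - z \<noteq> 0" using z by auto
  have "(\<Sum>n. z ^ n) = 1 / (1 - z)" using suminf_geometric[of z] z by simp
  also have "Re \<dots> = Re (1 - z) / (cmod (1 - z))\<^sup>2"
    by (simp add: Re_divide cmod_power2)
  finally have "2 * Re (\<Sum>n. z ^ n) - 1 = (2 * Re (1 - z) - (cmod (1 - z))\<^sup>2) / (cmod (1 - z))\<^sup>2"
    using nz by (simp add: field_simps)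
  also have "2 * Re (1 - z) - (cmod (1 - z))\<^sup>2 = 1 - (cmod z)\<^sup>2"
    unfolding cmod_power2 by (simp add: power2_eq_square algebra_simps)
  finally show ?thesis unfolding poisson_def by (simp add: z(1) flip: z_def)
qed

lemma poisson_sym: "poisson (of_real r * circ t) y = poisson (of_real r * circ y) t"
proof -
  have "cmod (1 - of_real r * circ t * cnj (circ y))
      = cmod (cnj (1 - of_real r * circ t * cnj (circ y)))"
    by (simp only: complex_mod_cnj)
  then show ?thesis by (simp add: poisson_def norm_mult mult_ac)
qed

lemma continuous_on_poisson: "cmod w < 1 \<Longrightarrow> continuous_on A (\<lambda>y. poisson w y)"
  unfolding poisson_def using poisson_denominator_pos(1)[of w] by (intro continuous_intros) fastforce

lemma integral_poisson:
  assumes r: "0 \<le> r" "r < 1"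
  shows "(\<integral>t. poisson (of_real r * circ t) y \<partial>lebesgue_01) = 1"
    "(\<integral>t. poisson (of_real r * circ y) t \<partial>lebesgue_01) = 1"
proof -
  have s: "summable (\<lambda>n. cmod (cnj (circ y) ^ n) * r ^ n)"
    using r by (simp add: norm_power summable_geometric)
  have cm: "cmod (complex_of_real r * circ t) < 1" for t using r by (simp add: norm_mult)
  let ?f = "\<lambda>t. \<Sum>n. cnj (circ y) ^ n * (of_real r * circ t) ^ n"
  have "poisson (of_real r * circ t) y = 2 * Re (?f t) - 1" for t
  proof -
    have "(\<lambda>n. cnj (circ y) ^ n * (of_real r * circ t) ^ n)
        = (\<lambda>n. (of_real r * circ t * cnj (circ y)) ^ n)"
      by (simp add: fun_eq_iff power_mult_distrib)
    then show ?thesis by (simp only: poisson_series[OF cm])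
  qed
  moreover have "integrable lebesgue_01 ?f"
  proof (rule leb.integrable_01_bounded)
    have [measurable]: "circ \<in> borel_measurable lebesgue_01"
      by (intro leb.measurable_01_continuous continuous_intros)
    show "?f \<in> borel_measurable lebesgue_01" by measurable
    show "cmod (?f t) \<le> (\<Sum>n. cmod (cnj (circ y) ^ n) * r ^ n)" for t
      using summable_norm[OF summable_cmod_powser[OF s r(1), of t]] r
      by (simp add: norm_mult norm_power)
  qed
  ultimately show "(\<integral>t. poisson (of_real r * circ t) y \<partial>lebesgue_01) = 1"
    using circle_mean[OF s r(1)] by (simp add: leb.prob_space)
  then show "(\<integral>t. poisson (of_real r * circ y) t \<partial>lebesgue_01) = 1"
    by (simp add: poisson_sym)
qed

section \<open>The Cauchy transform of a measure\<close>

lemma summable_unit_powser: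
  fixes w :: complex
  assumes "\<And>n. cmod (a n) \<le> 1" "cmod w < 1"
  shows "summable (\<lambda>n. cmod (a n * w ^ n))"
proof (rule summable_comparison_test'[OF summable_geometric])
  show "norm (cmod w) < 1" using assms by simp
  show "norm (cmod (a n * w ^ n)) \<le> cmod w ^ n" for n
    using mult_right_mono[OF assms(1)[of n], of "cmod w ^ n"] by (simp add: norm_mult norm_power)
qed

context measure_01 begin

definition cauchy :: "complex \<Rightarrow> complex" where
  "cauchy w = (\<Sum>n. fourier_coeff \<mu> n * w ^ n)"

lemma cmod_fourier_coeff_le: "cmod (fourier_coeff \<mu> n) \<le> 1"
proof -
  have "cmod (fourier_coeff \<mu> n) \<le> (\<integral>y. cmod (cnj (circ y) ^ n) \<partial>\<mu>)"
    unfolding fourier_coeff_circ by (rule integral_norm_bound)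
  then show ?thesis by (simp add: norm_power prob_space)
qed

lemmas summable_cauchy = summable_unit_powser[OF cmod_fourier_coeff_le]

lemma cauchy_sums: "cmod w < 1 \<Longrightarrow> (\<lambda>n. fourier_coeff \<mu> n * w ^ n) sums cauchy w"
  unfolding cauchy_def using summable_sums[OF summable_norm_cancel[OF summable_cauchy]] .

lemma cauchy_0: "cauchy 0 = 1"
  using sums_unique2[OF cauchy_sums[of 0] powser_sums_zero[of "fourier_coeff \<mu>"]]
  by (simp add: fourier_coeff_0)

lemma holomorphic_cauchy: "cauchy holomorphic_on ball 0 1"
  by (rule power_series_holomorphic[of 0 1 "fourier_coeff \<mu>"]) (simp add: cauchy_sums)

text \<open>
  Summing the geometric series under the integral exhibits the Poisson integral of the measure
  as 2 Re F - 1, where F is its Cauchy transform. In particular Re F \<ge> 1/2, so that 1/F is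
  defined on the whole disk and 1 - 1/F maps the disk into itself.
\<close>

lemma integral_poisson_eq:
  assumes w: "cmod w < 1"
  shows "(\<integral>y. poisson w y \<partial>\<mu>) = 2 * Re (cauchy w) - 1"
proof -
  have sm: "summable (\<lambda>n. cmod (w ^ n))"
    using w by (simp add: norm_power summable_geometric)
  let ?f = "\<lambda>y. \<Sum>n. w ^ n * cnj (circ y) ^ n"
  have geo: "?f y = 1 / (1 - w * cnj (circ y))" for y
    using suminf_geometric[of "w * cnj (circ y)"] w
    by (simp add: norm_mult power_mult_distrib)
  have "1 - w * cnj (circ y) \<noteq> 0" for y
    using poisson_denominator_pos(1)[OF w, of y] by auto
  then have int: "integrable \<mu> ?f"
    unfolding geo by (intro integrable_01 continuous_intros) blast
  have "(\<lambda>n. w ^ n * (\<integral>y. cnj (circ y) ^ n \<partial>\<mu>)) sums (\<integral>y. ?f y \<partial>\<mu>)"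
    by (rule integral_series[OF sm, where B=1])
       (auto simp: norm_power intro!: measurable_01_continuous continuous_intros)
  then have "(\<integral>y. ?f y \<partial>\<mu>) = cauchy w"
    using cauchy_sums[OF w] by (simp add: fourier_coeff_circ mult.commute sums_iff)
  moreover have "poisson w y = 2 * Re (?f y) - 1" for y
    by (simp add: poisson_series[OF w] power_mult_distrib)
  ultimately show ?thesis
    using int by (simp add: prob_space)
qed

lemma integral_poisson_nonneg: "cmod w < 1 \<Longrightarrow> 0 \<le> (\<integral>y. poisson w y \<partial>\<mu>)"
  by (intro integral_nonneg_AE) (simp add: poisson_nonneg)

lemma Re_cauchy: "cmod w < 1 \<Longrightarrow> 1 / 2 \<le> Re (cauchy w)"
  using integral_poisson_nonneg[of w] integral_poisson_eq[of w] by simp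

lemma cauchy_nonzero: "cmod w < 1 \<Longrightarrow> cauchy w \<noteq> 0"
  using Re_cauchy[of w] by auto

lemma continuous_on_circle_cauchy:
  assumes "0 \<le> r" "r < 1" shows "continuous_on UNIV (\<lambda>t. cauchy (of_real r * circ t))"
  by (rule continuous_on_compose2[OF holomorphic_on_imp_continuous_on[OF holomorphic_cauchy]])
     (use assms in \<open>auto intro!: continuous_intros simp: norm_mult\<close>)

text \<open>
  With b = 1 - 1/F this is 1 - |b|^2. It measures how far b is from having modulus 1; b is an
  inner function exactly if the circle means of this quantity tend to 0 at the boundary.
\<close>

definition defect :: "complex \<Rightarrow> real" where
  "defect w = 1 - (cmod (1 - 1 / cauchy w))\<^sup>2"

text \<open>
  This is the identity Re ((1 + b)/(1 - b)) = (1 - |b|^2)/|1 - b|^2 for b = 1 - 1/F, as F =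
  1/(1-b).
\<close>

lemma poisson_eq_defect:
  assumes w: "cmod w < 1"
  shows "(\<integral>y. poisson w y \<partial>\<mu>) = defect w * (cmod (cauchy w))\<^sup>2"
proof -
  have nz: "cauchy w \<noteq> 0" using cauchy_nonzero[OF w] .
  have "1 - 1 / cauchy w = (cauchy w - 1) / cauchy w" using nz by (simp add: field_simps)
  then have "defect w * (cmod (cauchy w))\<^sup>2 = (cmod (cauchy w))\<^sup>2 - (cmod (cauchy w - 1))\<^sup>2"
    using nz by (simp add: defect_def norm_divide power_divide field_simps)
  also have "\<dots> = 2 * Re (cauchy w) - 1"
    unfolding cmod_power2 by (simp add: power2_eq_square algebra_simps)
  finally show ?thesis using integral_poisson_eq[OF w] by simp
qed

lemma defect_bounds:
  assumes w: "cmod w < 1"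
  shows "0 \<le> defect w" "defect w \<le> 1" "defect w \<le> 4 * (\<integral>y. poisson w y \<partial>\<mu>)"
proof -
  have "0 \<le> defect w * (cmod (cauchy w))\<^sup>2"
    using integral_poisson_nonneg[OF w] poisson_eq_defect[OF w] by simp
  then show d: "0 \<le> defect w"
    using cauchy_nonzero[OF w] by (simp add: zero_le_mult_iff)
  show "defect w \<le> 1" by (simp add: defect_def)
  have "1 / 2 \<le> cmod (cauchy w)" using Re_cauchy[OF w] complex_Re_le_cmod order_trans by blast
  then have "(1 / 2)\<^sup>2 \<le> (cmod (cauchy w))\<^sup>2" by (intro power_mono) auto
  then have "defect w * (1 / 4) \<le> defect w * (cmod (cauchy w))\<^sup>2"
    using d by (intro mult_left_mono) (auto simp: power2_eq_square)
  then show "defect w \<le> 4 * (\<integral>y. poisson w y \<partial>\<mu>)"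
    using poisson_eq_defect[OF w] by simp
qed

lemma continuous_on_circle_defect:
  assumes "0 \<le> r" "r < 1" shows "continuous_on UNIV (\<lambda>t. defect (of_real r * circ t))"
  unfolding defect_def using assms cauchy_nonzero
  by (intro continuous_intros continuous_on_circle_cauchy) (auto simp: norm_mult)

context
  fixes c :: "nat \<Rightarrow> complex"
  assumes c: "inverse_coeffs (fourier_coeff \<mu>) c"
begin

lemma cmod_inverse_coeff_le: "cmod (c n) \<le> 1"
proof (cases n)
  case 0
  then show ?thesis using c by (simp add: inverse_coeffs_def)
next
  case (Suc m)
  have "(cmod (c (Suc m)))\<^sup>2 \<le> (\<Sum>j<Suc m. (cmod (c (Suc j)))\<^sup>2)"
    by (simp add: sum_nonneg)
  also have "\<dots> \<le> 1" by (rule sum_coeffs_le[OF c])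
  finally show ?thesis using Suc by (simp add: power_le_one_iff abs_square_le_1)
qed

text \<open>
  The coefficients c(n) are bounded by 1, because the squares of those with n \<ge> 1 have sum
  at most 1. So their power series converges on the disk, and the Cauchy product identifies it
  with 1/F.
\<close>

lemma inverse_cauchy_sums:
  assumes w: "cmod w < 1"
  shows "(\<lambda>n. c n * w ^ n) sums (1 / cauchy w)"
proof -
  note sc = summable_unit_powser[where a = c, OF cmod_inverse_coeff_le w]
  have "(\<lambda>k. \<Sum>i\<le>k. (c i * w ^ i) * (fourier_coeff \<mu> (k - i) * w ^ (k - i))) sums
     ((\<Sum>n. c n * w ^ n) * (\<Sum>n. fourier_coeff \<mu> n * w ^ n))"
    by (rule Cauchy_product_sums[OF sc summable_cauchy[OF w]])
  moreover have "(\<Sum>i\<le>k. (c i * w ^ i) * (fourier_coeff \<mu> (k - i) * w ^ (k - i))) = (if k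
      = 0 then 1 else 0)" for k
  proof -
    have "(\<Sum>i\<le>k. (c i * w ^ i) * (fourier_coeff \<mu> (k - i) * w ^ (k - i))) =
       (\<Sum>i\<le>k. c i * fourier_coeff \<mu> (k - i)) * w ^ k"
      unfolding sum_distrib_right
    proof (rule sum.cong[OF refl])
      fix i assume "i \<in> {..k}"
      then have "w ^ k = w ^ i * w ^ (k - i)" by (simp flip: power_add)
      then show "(c i * w ^ i) * (fourier_coeff \<mu> (k - i) * w ^ (k - i))
          = c i * fourier_coeff \<mu> (k - i) * w ^ k"
        by simp
    qed
    also have "(\<Sum>i\<le>k. c i * fourier_coeff \<mu> (k - i)) = (if k = 0 then 1 else 0)"
      using c by (cases k) (auto simp: inverse_coeffs_def fourier_coeff_0)
    finally show ?thesis by simp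
  qed
  ultimately have "(\<lambda>k. if k = 0 then 1 else 0) sums ((\<Sum>n. c n * w ^ n) * cauchy w)"
    by (simp add: cauchy_def)
  then have "(\<Sum>n. c n * w ^ n) * cauchy w = 1"
    using sums_single[of 0 "\<lambda>_. 1::complex"] by (simp add: sums_unique2)
  then have "(\<Sum>n. c n * w ^ n) = 1 / cauchy w"
    using cauchy_nonzero[OF w] by (simp add: field_simps)
  then show ?thesis using summable_sums[OF summable_norm_cancel[OF sc]] by simp
qed

text \<open>
  Parseval's identity for 1/F - 1 on the circle of radius r.
\<close>

lemma integral_defect:
  assumes r: "0 \<le> r" "r < 1"
  shows "(\<lambda>n. (cmod (c (Suc n)))\<^sup>2 * r ^ (2 * Suc n)) sums
    (1 - (\<integral>t. defect (of_real r * circ t) \<partial>lebesgue_01))"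
proof -
  define d where "d n = (if n = 0 then 0 else c n)" for n
  have d1: "cmod (d n) \<le> 1" for n using cmod_inverse_coeff_le by (simp add: d_def)
  have cm: "cmod (complex_of_real r * circ t) < 1" for t using r by (simp add: norm_mult)
  have sd: "summable (\<lambda>n. cmod (d n) * r ^ n)"
    using summable_unit_powser[OF d1, of "of_real r"] r by (simp add: norm_mult norm_power)
  have dsum: "(\<lambda>n. d n * w ^ n) sums (1 / cauchy w - 1)" if "cmod w < 1" for w
  proof -
    have "(\<lambda>n. c n * w ^ n - (if n = 0 then 1 else 0)) sums (1 / cauchy w - 1)"
      by (intro sums_diff inverse_cauchy_sums that sums_single[of 0 "\<lambda>_. 1::complex", simplified])
    moreover have "c n * w ^ n - (if n = 0 then 1 else 0) = d n * w ^ n" for n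
      using c by (simp add: d_def inverse_coeffs_def)
    ultimately show ?thesis by simp
  qed
  have "(\<lambda>n. (cmod (d n))\<^sup>2 * r ^ (2 * n)) sums
     (\<integral>t. (cmod (\<Sum>n. d n * (of_real r * circ t) ^ n))\<^sup>2 \<partial>lebesgue_01)"
    by (rule circle_parseval[OF sd r(1)])
  also have "(\<lambda>t. \<Sum>n. d n * (of_real r * circ t) ^ n) = (\<lambda>t. 1 / cauchy (of_real r * circ t) - 1)"
    using dsum[OF cm] by (simp add: sums_iff)
  also have "(\<lambda>t. (cmod (1 / cauchy (of_real r * circ t) - 1))\<^sup>2)
      = (\<lambda>t. 1 - defect (of_real r * circ t))"
    by (simp add: defect_def norm_minus_commute)
  also have "(\<integral>t. 1 - defect (of_real r * circ t) \<partial>lebesgue_01)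
      = 1 - (\<integral>t. defect (of_real r * circ t) \<partial>lebesgue_01)"
    using leb.integrable_01[OF continuous_on_circle_defect[OF r]] by (simp add: leb.prob_space)
  finally have "(\<lambda>n. (cmod (d n))\<^sup>2 * r ^ (2 * n))
      sums (1 - (\<integral>t. defect (of_real r * circ t) \<partial>lebesgue_01))" .
  then have "(\<lambda>n. (cmod (d (Suc n)))\<^sup>2 * r ^ (2 * Suc n)) sums
     (1 - (\<integral>t. defect (of_real r * circ t) \<partial>lebesgue_01))"
    by (subst sums_Suc_iff) (simp add: d_def)
  then show ?thesis by (simp add: d_def)
qed

end

end

section \<open>Singular measures and inverse coefficients\<close>

lemma circ_inj:
  assumes "circ t = circ y" "0 \<le> t" "t < 1" "0 \<le> y" "y < 1"
  shows "t = y"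
proof -
  have "exp (\<i> * of_real (2 * pi * t)) = exp (\<i> * of_real (2 * pi * y))"
    using assms(1) by (simp add: circ_def cis_conv_exp)
  then obtain n :: int where "\<i> * of_real (2 * pi * t)
      = \<i> * of_real (2 * pi * y) + (of_int (2 * n) * pi) * \<i>"
    unfolding exp_eq by blast
  then have "\<i> * complex_of_real (2 * pi * t) = \<i> * of_real (2 * pi * y + of_int (2 * n) * pi)"
    by (simp add: algebra_simps)
  then have "2 * pi * t = 2 * pi * y + of_int (2 * n) * pi"
    by (simp only: mult_cancel_left of_real_eq_iff) simp
  then have "2 * pi * (t - y) = 2 * pi * of_int n" by (simp add: algebra_simps)
  then have *: "t - y = of_int n" by simp
  then have "\<bar>real_of_int n\<bar> < 1" using assms by linarith
  then have "n = 0" by linarith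
  with * show ?thesis by simp
qed

lemma borel_indicator_01:
  assumes "A \<in> sets borel" shows "(indicator A :: real \<Rightarrow> real) \<in> borel_measurable lebesgue_01"
proof -
  have "(indicator A :: real \<Rightarrow> real) \<in> borel_measurable (restrict_space borel {0..<1})"
    using assms by (intro measurable_restrict_space1) simp
  then show ?thesis by (simp add: measurable_cong_sets[OF leb.sets_01])
qed

context measure_01 begin

lemma integrable_poisson_pair:
  assumes r: "0 \<le> r" "r < 1" and A: "A \<in> sets borel"
  shows "integrable (lebesgue_01 \<Otimes>\<^sub>M \<mu>) (\<lambda>(t, y). indicator A t * poisson (of_real r * circ t) y)"
proof -
  interpret P: pair_prob_space lebesgue_01 \<mu> ..
  have [measurable]: "circ \<in> borel_measurable lebesgue_01" "circ \<in> borel_measurable \<mu>"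
    by (intro leb.measurable_01_continuous measurable_01_continuous continuous_intros)+
  have [measurable]: "(\<lambda>y. cnj (circ y)) \<in> borel_measurable \<mu>"
    by (intro measurable_01_continuous continuous_intros)
  note borel_indicator_01[OF A, measurable]
  have cm: "cmod (complex_of_real r * circ t) = r" for t using r by (simp add: norm_mult)
  show ?thesis
  proof (rule P.integrable_const_bound)
    have "norm (indicator A t * poisson (of_real r * circ t) y) \<le> 1 / (1 - r)\<^sup>2" for t y
      using poisson_nonneg[of "of_real r * circ t" y] poisson_le[of "of_real r * circ t" y] r
      by (auto simp: cm indicator_def)
    then show "AE x in lebesgue_01 \<Otimes>\<^sub>M \<mu>. norm (case x of (t, y) \<Rightarrow> indicator A t
        * poisson (of_real r * circ t) y)
       \<le> 1 / (1 - r)\<^sup>2" by auto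
    show "(\<lambda>(t, y). indicator A t * poisson (of_real r
        * circ t) y) \<in> borel_measurable (lebesgue_01 \<Otimes>\<^sub>M \<mu>)"
      unfolding poisson_def by measurable
  qed
qed

text \<open>
  A measure that is not singular dominates a positive multiple of Lebesgue measure on some set
  of positive length. To see this, compare it with Lebesgue measure scaled by 1/(n+1), using a
  Hahn decomposition for each n. If the part on which the scaled Lebesgue measure is smaller
  were always a null set for Lebesgue measure, the union of these parts would separate the two
  measures.
\<close>

lemma lebesgue_part_or_singular:
  assumes "\<not> mutually_singular \<mu> lebesgue_01"
  obtains e B where "e > 0" "B \<in> sets borel" "B \<subseteq> {0..<1}" "measure lebesgue_01 B > 0"
    "\<And>X. X \<in> sets \<mu> \<Longrightarrow> X \<subseteq> B \<Longrightarrow> ennreal e * emeasure lebesgue_01 X \<le> emeasure \<mu> X"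
proof (rule ccontr)
  assume no: "\<not> thesis"
  have sets_eq: "sets \<mu> = sets lebesgue_01" using sets_01 leb.sets_01 by simp
  have space_eq: "space \<mu> = space lebesgue_01" using space_01 leb.space_01 by simp
  define e where "e n = 1 / real (Suc n)" for n
  have e: "e n > 0" for n by (simp add: e_def)
  have fin: "finite_measure (scale_measure (ennreal (e n)) lebesgue_01)" for n
    using leb.emeasure_space_1 by (intro finite_measureI) (simp add: ennreal_mult_eq_top_iff)
  have "\<exists>Y\<in>sets \<mu>. (\<forall>X\<in>sets \<mu>. X \<subseteq> Y \<longrightarrow> ennreal (e n) * emeasure lebesgue_01 X \<le> emeasure \<mu> X) \<and>
     (\<forall>X\<in>sets \<mu>. X \<inter> Y = {} \<longrightarrow> emeasure \<mu> X \<le> ennreal (e n) * emeasure lebesgue_01 X)" for n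
    using finite_unsigned_Hahn_decomposition[OF finite_measure_axioms fin[of n]] sets_eq by simp
  then obtain Y where Y: "\<And>n. Y n \<in> sets \<mu>"
    and Y1: "\<And>n X. X \<in> sets \<mu> \<Longrightarrow> X \<subseteq> Y n \<Longrightarrow> ennreal (e n) * emeasure lebesgue_01 X \<le> emeasure \<mu> X"
    and Y2: "\<And>n X. X \<in> sets \<mu> \<Longrightarrow> X \<inter> Y n = {} \<Longrightarrow> emeasure \<mu> X \<le> ennreal (e n) * emeasure lebesgue_01 X"
    by metis
  have null: "emeasure lebesgue_01 (Y n) = 0" for n
  proof (rule ccontr)
    assume "emeasure lebesgue_01 (Y n) \<noteq> 0"
    then have "measure lebesgue_01 (Y n) > 0"
      by (simp add: leb.emeasure_eq_measure zero_less_measure_iff)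
    moreover have "Y n \<in> sets borel" "Y n \<subseteq> {0..<1}"
      using Y[of n] unfolding sets_01 by (auto simp: sets_restrict_space)
    ultimately show False using that[OF e _ _ _ Y1] no by blast
  qed
  define S where "S = (\<Union>n. Y n)"
  have S: "S \<in> sets \<mu>" using Y by (auto simp: S_def)
  have "emeasure lebesgue_01 S = 0"
    unfolding S_def using null Y sets_eq by (intro emeasure_UN_eq_0) auto
  moreover have "emeasure \<mu> (space \<mu> - S) = 0"
  proof -
    have "measure \<mu> (space \<mu> - S) \<le> e n" for n
    proof -
      have "emeasure \<mu> (space \<mu> - S) \<le> ennreal (e n) * emeasure lebesgue_01 (space \<mu> - S)"
        using S by (intro Y2) (auto simp: S_def)
      also have "\<dots> \<le> ennreal (e n) * 1"
        by (intro mult_left_mono leb.measure_le_1) auto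
      finally show ?thesis using e[of n] by (simp add: emeasure_eq_measure)
    qed
    moreover have "e \<longlonglongrightarrow> 0"
      unfolding e_def using LIMSEQ_inverse_real_of_nat by (simp add: inverse_eq_divide)
    ultimately have "measure \<mu> (space \<mu> - S) \<le> 0"
      by (intro LIMSEQ_le_const) auto
    then show ?thesis by (simp add: emeasure_eq_measure measure_le_0_iff)
  qed
  ultimately have "mutually_singular \<mu> lebesgue_01"
    using S sets_eq by (auto simp: mutually_singular_def)
  with assms show False by simp
qed

lemma integral_le_of_lebesgue_part:
  assumes e: "e > 0" and B: "B \<in> sets borel" "B \<subseteq> {0..<1}"
    and le: "\<And>X. X \<in> sets \<mu> \<Longrightarrow> X \<subseteq> B \<Longrightarrow> ennreal e * emeasure lebesgue_01 X \<le> emeasure \<mu> X"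
    and g: "continuous_on UNIV g" "\<And>y. 0 \<le> g y"
  shows "e * (\<integral>y. indicator B y * g y \<partial>lebesgue_01) \<le> (\<integral>y. g y \<partial>\<mu>)"
proof -
  have sets_eq: "sets lebesgue_01 = sets \<mu>" using sets_01 leb.sets_01 by simp
  note borel_indicator_01[OF B(1), measurable]
  have [measurable]: "B \<in> sets lebesgue_01"
    unfolding leb.sets_01 using B by (auto simp: sets_restrict_space)
  have [measurable]: "g \<in> borel_measurable lebesgue_01" "g \<in> borel_measurable \<mu>"
    using leb.measurable_01_continuous[OF g(1)] measurable_01_continuous[OF g(1)] by auto
  let ?D = "density lebesgue_01 (\<lambda>y. ennreal e * indicator B y)"
  have "?D \<le> \<mu>"
  proof (subst le_measure)
    show "sets ?D = sets \<mu>" by (simp add: sets_eq)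
    show "\<forall>X\<in>sets ?D. emeasure ?D X \<le> emeasure \<mu> X"
    proof
      fix X assume "X \<in> sets ?D"
      then have X[measurable]: "X \<in> sets lebesgue_01" by simp
      have "emeasure ?D X = (\<integral>\<^sup>+y. ennreal e * indicator (B \<inter> X) y \<partial>lebesgue_01)"
        by (subst emeasure_density) (auto intro!: nn_integral_cong simp: indicator_def)
      also have "\<dots> = ennreal e * emeasure lebesgue_01 (B \<inter> X)"
        by (rule nn_integral_cmult_indicator) simp
      also have "\<dots> \<le> emeasure \<mu> (B \<inter> X)"
        by (rule le) (auto simp flip: sets_eq)
      also have "\<dots> \<le> emeasure \<mu> X"
        using X by (intro emeasure_mono) (auto simp: sets_eq)
      finally show "emeasure ?D X \<le> emeasure \<mu> X" .
    qed
  qed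
  then have "(\<integral>\<^sup>+y. ennreal (g y) \<partial>?D) \<le> (\<integral>\<^sup>+y. ennreal (g y) \<partial>\<mu>)"
    by (intro nn_integral_mono_measure) (simp_all add: sets_eq)
  also have "(\<integral>\<^sup>+y. ennreal (g y) \<partial>?D) = (\<integral>\<^sup>+y. ennreal (e * (indicator B y * g y)) \<partial>lebesgue_01)"
    using e g by (subst nn_integral_density)
      (auto intro!: nn_integral_cong simp: ennreal_mult indicator_def)
  also have "\<dots> = ennreal (\<integral>y. e * (indicator B y * g y) \<partial>lebesgue_01)"
    using e g leb.integrable_01[OF g(1)]
    by (intro nn_integral_eq_integral integrable_mult_right Bochner_Integration.integrable_bound[OF
        leb.integrable_01[OF g(1)]])
       (auto simp: indicator_def)
  also have "(\<integral>\<^sup>+y. ennreal (g y) \<partial>\<mu>) = ennreal (\<integral>y. g y \<partial>\<mu>)"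
    using g by (intro nn_integral_eq_integral integrable_01) auto
  finally show ?thesis using g(2) by (simp add: ennreal_le_iff integral_nonneg_AE)
qed

text \<open>
  Kolmogorov's estimate for Cauchy transforms, with the exponent 1/2. The square root of F takes
  values in the sector |arg| \<le> pi/4, so its modulus is at most sqrt 2 times its real part;
  and the mean of the real part over a circle is the value at the centre, which is 1. The bound
  does not depend on the radius.
\<close>

lemma integral_sqrt_cauchy_le:
  assumes r: "0 \<le> r" "r < 1"
  shows "(\<integral>t. cmod (csqrt (cauchy (of_real r * circ t))) \<partial>lebesgue_01) \<le> sqrt 2"
    and "continuous_on UNIV (\<lambda>t. csqrt (cauchy (of_real r * circ t)))"
proof -
  let ?s = "\<lambda>t. csqrt (cauchy (of_real r * circ t))"
  have cm: "cmod (complex_of_real r * circ t) < 1" for t using r by (simp add: norm_mult)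
  have np: "cauchy w \<notin> \<real>\<^sub>\<le>\<^sub>0" if "cmod w < 1" for w
    using Re_cauchy[OF that] by (auto simp: complex_nonpos_Reals_iff)
  have hol: "(\<lambda>w. csqrt (cauchy w)) holomorphic_on ball 0 1"
    by (intro holomorphic_on_csqrt' holomorphic_cauchy) (use np in auto)
  show cont: "continuous_on UNIV ?s"
    by (rule continuous_on_compose2[OF holomorphic_on_imp_continuous_on[OF hol]])
       (auto intro!: continuous_intros simp: cm)
  have "(\<integral>t. ?s t \<partial>lebesgue_01) = csqrt (cauchy 0)"
    by (rule circle_mean_holomorphic[OF hol r])
  then have "Re (\<integral>t. ?s t \<partial>lebesgue_01) = 1" by (simp add: cauchy_0)
  then have mean: "(\<integral>t. Re (?s t) \<partial>lebesgue_01) = 1"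
    by (subst integral_Re[OF leb.integrable_01[OF cont]])
  have "cmod (?s t) \<le> sqrt 2 * Re (?s t)" for t
  proof (rule power2_le_imp_le)
    have "Re ((?s t)\<^sup>2) \<ge> 0" using Re_cauchy[OF cm, of t] by simp
    then have "(Im (?s t))\<^sup>2 \<le> (Re (?s t))\<^sup>2" by (simp add: power2_eq_square)
    then show "(cmod (?s t))\<^sup>2 \<le> (sqrt 2 * Re (?s t))\<^sup>2"
      unfolding cmod_power2 by (simp add: power_mult_distrib)
    show "0 \<le> sqrt 2 * Re (?s t)" using csqrt_principal[of "cauchy (of_real r * circ t)"] by auto
  qed
  then have "(\<integral>t. cmod (?s t) \<partial>lebesgue_01) \<le> (\<integral>t. sqrt 2 * Re (?s t) \<partial>lebesgue_01)"
    by (intro integral_mono leb.integrable_01 continuous_intros cont) auto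
  also have "\<dots> = sqrt 2" using mean by simp
  finally show "(\<integral>t. cmod (?s t) \<partial>lebesgue_01) \<le> sqrt 2" .
qed

end

text \<open>
  Any sequence in [0,1) with limit 1 would do; it turns limits at the boundary of the disk into
  limits of sequences, as the dominated convergence theorem requires.
\<close>

definition radius :: "nat \<Rightarrow> real" where "radius n = 1 - 1 / real (n + 2)"

lemma radius: "0 \<le> radius n" "radius n < 1" "radius \<longlonglongrightarrow> 1"
proof -
  show "0 \<le> radius n" "radius n < 1" by (simp_all add: radius_def)
  have "(\<lambda>n. 1 / real (n + 2)) \<longlonglongrightarrow> 0"
    using LIMSEQ_ignore_initial_segment[OF lim_1_over_n, of 2] by simp
  then have "(\<lambda>n. 1 - 1 / real (n + 2)) \<longlonglongrightarrow> 1 - 0" by (intro tendsto_intros)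
  then show "radius \<longlonglongrightarrow> 1" by (simp add: radius_def[abs_def])
qed

text \<open>
  The Poisson kernel concentrates at its boundary point. Angles close to 1 describe boundary
  points close to the one of angle 0; requiring that U contains 1 keeps the rest of [0,1) away
  from y also when y = 0.
\<close>

lemma poisson_mass_off_neighbourhood:
  assumes U: "open U" "y \<in> U" "1 \<in> U" and y: "0 \<le> y" "y < 1"
  shows "(\<lambda>n. \<integral>t. indicator (- U) t * poisson (of_real (radius n) * circ t) y \<partial>lebesgue_01) \<longlonglongrightarrow> 0"
proof -
  have "\<exists>m>0. \<forall>t\<in>{0..1} - U. m \<le> cmod (circ t - circ y)"
  proof (cases "{0..1} - U = {}")
    case False
    have "compact ({0..1} - U)" by (intro compact_diff U) simp
    moreover have "continuous_on ({0..1} - U) (\<lambda>t. cmod (circ t - circ y))"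
      by (intro continuous_intros)
    ultimately obtain t0 where t0: "t0 \<in> {0..1} - U"
      and min: "\<forall>t\<in>{0..1} - U. cmod (circ t0 - circ y) \<le> cmod (circ t - circ y)"
      using continuous_attains_inf False by blast
    have "t0 \<noteq> 1" "t0 \<noteq> y" using t0 U by auto
    then have "cmod (circ t0 - circ y) > 0"
      using circ_inj[of t0 y] t0 y by auto
    with min show ?thesis by blast
  qed (auto intro: exI[of _ 1])
  then obtain m where m: "m > 0" "\<And>t. 0 \<le> t \<Longrightarrow> t < 1 \<Longrightarrow> t \<notin> U \<Longrightarrow> m \<le> cmod (circ t - circ y)"
    by force
  define B where "B n = (1 - (radius n)\<^sup>2) / (m - (1 - radius n))\<^sup>2" for n
  have "B \<longlonglongrightarrow> (1 - 1\<^sup>2) / (m - (1 - 1))\<^sup>2"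
    unfolding B_def[abs_def] using m(1) by (intro tendsto_intros radius) auto
  then have B: "B \<longlonglongrightarrow> 0" by simp
  have ev: "\<forall>\<^sub>F n in sequentially. 1 - m < radius n"
    using m(1) by (intro order_tendstoD(1)[OF radius(3)]) simp
  have cm: "cmod (complex_of_real (radius n) * circ t) < 1" for n t
    using radius(1,2)[of n] by (simp add: norm_mult)
  have "(\<integral>t. indicator (- U) t * poisson (of_real (radius n) * circ t) y \<partial>lebesgue_01) \<le> B n"
    if n: "1 - m < radius n" for n
  proof -
    have B0: "0 \<le> B n" unfolding B_def using radius(1,2)[of n] by (simp add: power_le_one)
    have le: "indicator (- U) t * poisson (of_real (radius n) * circ t) y \<le> B n" if t: "0
        \<le> t" "t < 1" for t
    proof (cases "t \<in> U")
      case False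
      have "m - (1 - radius n) \<le> cmod (circ t - circ y) - cmod (circ t - of_real (radius n) * circ t)"
      proof -
        have "circ t - of_real (radius n) * circ t = of_real (1 - radius n) * circ t"
          by (simp add: algebra_simps)
        then have "cmod (circ t - of_real (radius n) * circ t) = 1 - radius n"
          using radius(1,2)[of n] by (simp only: norm_mult norm_of_real norm_circ) simp
        then show ?thesis using m(2)[OF t False] by simp
      qed
      also have "\<dots> \<le> cmod (circ y - of_real (radius n) * circ t)"
        using norm_triangle_ineq2[of "circ t - circ y" "circ t - of_real (radius n) * circ t"]
        by (simp add: norm_minus_commute)
      also have "\<dots> = cmod ((circ y - of_real (radius n) * circ t) * cnj (circ y))"
        by (simp add: norm_mult)
      also have "\<dots> = cmod (1 - of_real (radius n) * circ t * cnj (circ y))"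
        by (simp add: algebra_simps)
      finally have "poisson (of_real (radius n) * circ t) y \<le> B n"
        unfolding poisson_def B_def using n radius(1,2)[of n]
        by (intro frac_le power_mono) (auto simp: norm_mult power_le_one)
      with False show ?thesis by simp
    qed (simp add: B0)
    have "(\<integral>t. indicator (- U) t * poisson (of_real (radius n) * circ t) y \<partial>lebesgue_01)
        \<le> (\<integral>t. B n \<partial>lebesgue_01)"
      using le B0 by (intro Bochner_Integration.integral_mono') (auto simp: leb.space_01)
    then show ?thesis by (simp add: leb.prob_space)
  qed
  then have "\<forall>\<^sub>F n in sequentially.
      (\<integral>t. indicator (- U) t * poisson (of_real (radius n) * circ t) y \<partial>lebesgue_01) \<le> B n"
    using ev by (auto elim: eventually_mono)
  then show ?thesis
    by (intro tendsto_sandwich[OF _ _ tendsto_const B])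
       (auto intro!: always_eventually integral_nonneg_AE simp: poisson_nonneg[OF cm])
qed

context measure_01 begin

context
  fixes c :: "nat \<Rightarrow> complex"
  assumes c: "inverse_coeffs (fourier_coeff \<mu>) c"
begin

text \<open>
  The defect is at most 1 and at most four times the Poisson integral P of the measure. Enclose
  a Lebesgue null set carrying the measure in an open set U of length at most \<epsilon>. The
  defect contributes at most \<epsilon> on U. Off U the mass of P tends to 0, since P is an
  average of Poisson kernels whose boundary points lie in U. So the circle means of the defect
  become arbitrarily small, but by Parseval they are at least 1 minus the sum in question.
\<close>

lemma sum_coeffs_eq_1_if_singular:
  assumes sing: "mutually_singular \<mu> lebesgue_01"
  shows "(\<lambda>n. (cmod (c (Suc n)))\<^sup>2) sums 1"
proof -
  define a where "a n = (cmod (c (Suc n)))\<^sup>2" for n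
  have a0: "0 \<le> a n" for n by (simp add: a_def)
  have le_1: "sum a {..<n} \<le> 1" for n
    unfolding a_def[abs_def] by (rule sum_coeffs_le[OF c])
  have sa: "summable a"
  proof (rule bounded_imp_summable)
    show "(\<Sum>k\<le>n. a k) \<le> 1" for n
      using le_1[of "Suc n"] by (simp only: lessThan_Suc_atMost)
  qed (rule a0)
  have le1: "suminf a \<le> 1"
    by (intro suminf_le_const sa le_1)
  obtain S where S: "S \<in> sets \<mu>" "emeasure \<mu> (space \<mu> - S) = 0" "emeasure lebesgue_01 S = 0"
    using sing by (auto simp: mutually_singular_def)
  have Sb: "S \<in> sets borel" "S \<subseteq> {0..<1}"
    using S(1) unfolding sets_01 by (auto simp: sets_restrict_space)
  have "emeasure lborel S = 0"
    using S(3) Sb unfolding lebesgue_01_def by (simp add: emeasure_restrict_space)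
  then have T: "emeasure lborel (insert 1 S) = 0"
    using Sb emeasure_Un_null_set[of S lborel "{1}"] by (simp add: null_setsI)
  have "1 - suminf a \<le> \<epsilon>" if \<epsilon>: "\<epsilon> > 0" for \<epsilon>
  proof -
    obtain U where U: "open U" "insert 1 S \<subseteq> U" "emeasure lborel (U - insert 1 S) < ennreal \<epsilon>"
      using outer_regular_lborel[of "insert 1 S" \<epsilon>] Sb \<epsilon> by auto
    have "emeasure lborel U \<le> emeasure lborel (U - insert 1 S) + emeasure lborel (insert 1 S)"
      using U Sb by (intro order_trans[OF emeasure_mono emeasure_subadditive]) auto
    then have Ule: "emeasure lborel U \<le> ennreal \<epsilon>" using U(3) T by simp
    have U1: "U \<inter> {0..<1} \<in> sets lebesgue_01"
      unfolding leb.sets_01 using U(1) by (auto simp: sets_restrict_space)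
    have "emeasure lebesgue_01 (U \<inter> {0..<1}) \<le> ennreal \<epsilon>"
      unfolding lebesgue_01_def using U(1) Ule
      by (subst emeasure_restrict_space) (auto intro: order_trans[OF emeasure_mono])
    then have mU: "measure lebesgue_01 (U \<inter> {0..<1}) \<le> \<epsilon>"
      using \<epsilon> by (simp add: leb.emeasure_eq_measure)
    have cU: "- U \<in> sets borel" using U(1) by auto
    define J where "J n = (\<integral>y. (\<integral>t. indicator (- U) t * poisson (of_real (radius n)
        * circ t) y \<partial>lebesgue_01) \<partial>\<mu>)" for n
    interpret P: pair_prob_space lebesgue_01 \<mu> ..
    note pair = integrable_poisson_pair[OF radius(1,2) cU]
    have cm: "cmod (complex_of_real (radius n) * circ t) < 1" for n t
      using radius(1,2)[of n] by (simp add: norm_mult)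
    have "J \<longlonglongrightarrow> (\<integral>y. 0 \<partial>\<mu>)"
      unfolding J_def[abs_def]
    proof (rule integral_dominated_convergence[where w="\<lambda>_. 1"])
      show "(\<lambda>y. \<integral>t. indicator (- U) t * poisson (of_real (radius n)
          * circ t) y \<partial>lebesgue_01) \<in> borel_measurable \<mu>" for n
        by (rule borel_measurable_integrable[OF P.integrable_snd[OF pair]])
      have "AE y in \<mu>. y \<in> S"
        using S(1,2) by (intro AE_I[of _ _ "space \<mu> - S"]) auto
      then show "AE y in \<mu>. (\<lambda>n. \<integral>t. indicator (- U) t * poisson (of_real (radius n)
          * circ t) y \<partial>lebesgue_01) \<longlonglongrightarrow> 0"
        by eventually_elim (use U Sb in \<open>auto intro!: poisson_mass_off_neighbourhood\<close>)
      have "\<bar>\<integral>t. indicator (- U) t * poisson (of_real (radius n) * circ t) y \<partial>lebesgue_01\<bar> \<le> 1" for n y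
      proof -
        have "(\<integral>t. indicator (- U) t * poisson (of_real (radius n) * circ t) y \<partial>lebesgue_01)
           \<le> (\<integral>t. poisson (of_real (radius n) * circ t) y \<partial>lebesgue_01)"
          unfolding poisson_sym[of _ _ y]
          using cm by (intro Bochner_Integration.integral_mono' leb.integrable_01 continuous_on_poisson)
             (auto simp: indicator_def poisson_nonneg)
        moreover have "0 \<le> (\<integral>t. indicator (- U) t * poisson (of_real (radius n)
            * circ t) y \<partial>lebesgue_01)"
          by (intro integral_nonneg_AE) (simp add: poisson_nonneg cm)
        ultimately show ?thesis using integral_poisson[OF radius(1,2)] by simp
      qed
      then show "AE y in \<mu>. norm (\<integral>t. indicator (- U) t * poisson (of_real (radius n)
          * circ t) y \<partial>lebesgue_01) \<le> 1" for n
        by simp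
    qed auto
    then have J: "J \<longlonglongrightarrow> 0" by simp
    have "1 - suminf a \<le> \<epsilon> + 4 * J n" for n
    proof -
      let ?w = "\<lambda>t. of_real (radius n) * circ t"
      note d = integral_defect[OF c radius(1,2)[of n]]
      have "1 - (\<integral>t. defect (?w t) \<partial>lebesgue_01) \<le> suminf a"
      proof (rule sums_le[OF _ d summable_sums[OF sa]])
        show "(cmod (c (Suc k)))\<^sup>2 * radius n ^ (2 * Suc k) \<le> a k" for k
          unfolding a_def using radius(1,2)[of n] by (intro mult_right_le_one_le power_le_one) auto
      qed
      moreover have "(\<integral>t. defect (?w t) \<partial>lebesgue_01) \<le> \<epsilon> + 4 * J n"
      proof -
        have intp: "integrable lebesgue_01 (\<lambda>t. \<integral>y. indicator (- U) t * poisson (?w t) y \<partial>\<mu>)"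
          by (rule P.integrable_fst[OF pair])
        have intU: "integrable lebesgue_01 (indicator (U \<inter> {0..<1}) :: real \<Rightarrow> real)"
          using U1 by (intro integrable_real_indicator) (auto simp: leb.emeasure_eq_measure)
        have "(\<integral>t. defect (?w t) \<partial>lebesgue_01) \<le>
          (\<integral>t. indicator (U \<inter> {0..<1}) t + 4 * (\<integral>y. indicator (- U) t
              * poisson (?w t) y \<partial>\<mu>) \<partial>lebesgue_01)"
        proof (rule integral_mono)
          show "integrable lebesgue_01 (\<lambda>t. defect (?w t))"
            by (intro leb.integrable_01 continuous_on_circle_defect radius)
          show "integrable lebesgue_01 (\<lambda>t. indicator (U \<inter> {0..<1}) t + 4 * (\<integral>y. indicator (- U) t
              * poisson (?w t) y \<partial>\<mu>))"
            using intp intU by simp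
          show "defect (?w t) \<le> indicator (U \<inter> {0..<1}) t + 4 * (\<integral>y. indicator (- U) t
              * poisson (?w t) y \<partial>\<mu>)"
            if "t \<in> space lebesgue_01" for t
            using defect_bounds[OF cm, of n t] that by (cases "t \<in> U") (auto simp: leb.space_01)
        qed
        also have "\<dots> = measure lebesgue_01 (U \<inter> {0..<1}) +
            4 * (\<integral>t. (\<integral>y. indicator (- U) t * poisson (?w t) y \<partial>\<mu>) \<partial>lebesgue_01)"
          using intp intU U1 by (simp add: leb.space_01 Int_absorb1)
        also have "(\<integral>t. (\<integral>y. indicator (- U) t * poisson (?w t) y \<partial>\<mu>) \<partial>lebesgue_01) = J n"
          unfolding J_def by (rule P.Fubini_integral[OF pair, symmetric])
        finally show ?thesis using mU by linarith
      qed
      ultimately show ?thesis by linarith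
    qed
    moreover have "(\<lambda>n. \<epsilon> + 4 * J n) \<longlonglongrightarrow> \<epsilon> + 4 * 0" by (intro tendsto_intros J)
    ultimately show "1 - suminf a \<le> \<epsilon>" by (intro LIMSEQ_le_const) auto
  qed
  then have "1 - suminf a \<le> 0" by (rule field_le_epsilon) simp
  then have "suminf a = 1" using le1 by simp
  then show ?thesis using summable_sums[OF sa] unfolding a_def by simp
qed

text \<open>
  Suppose that the measure dominates e times Lebesgue measure on a set B of length \<beta> > 0.
  Then P \<ge> e b, where b is the Poisson integral of the indicator of B; it lies between 0 and
  1 and has mean \<beta> on every circle. On the other hand P is the defect times |F|^2. Where
  the square root of |F| is at most M, this bounds b by M^4/e times the defect; elsewhere b
  \<le> 1 \<le> sqrt |F| / M. Integrating, with Kolmogorov's estimate for the second term, gives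
  a bound for \<beta> in which the first term vanishes at the boundary by hypothesis. What
  remains is \<beta> \<le> sqrt 2 / M for every M > 0, which is absurd.
\<close>

lemma singular_if_sum_coeffs_eq_1:
  assumes sums1: "(\<lambda>n. (cmod (c (Suc n)))\<^sup>2) sums 1"
  shows "mutually_singular \<mu> lebesgue_01"
proof (rule ccontr)
  assume "\<not> mutually_singular \<mu> lebesgue_01"
  then obtain e B where e: "e > 0" and B: "B \<in> sets borel" "B \<subseteq> {0..<1}" "measure lebesgue_01 B > 0"
    and le: "\<And>X. X \<in> sets \<mu> \<Longrightarrow> X \<subseteq> B \<Longrightarrow> ennreal e * emeasure lebesgue_01 X \<le> emeasure \<mu> X"
    using lebesgue_part_or_singular by blast
  define \<beta> where "\<beta> = measure lebesgue_01 B"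
  have \<beta>: "\<beta> > 0" using B by (simp add: \<beta>_def)
  \<comment> \<open>The choice of M makes the remaining term sqrt 2 / M equal to \<beta> / sqrt 2, which is less than \<beta>.\<close>
  define M where "M = 2 / \<beta>"
  have M: "M > 0" using \<beta> by (simp add: M_def)
  define a where "a n = (cmod (c (Suc n)))\<^sup>2" for n
  interpret P: pair_prob_space lebesgue_01 lebesgue_01 ..
  have Bs: "B \<in> sets lebesgue_01"
    unfolding leb.sets_01 using B by (auto simp: sets_restrict_space)
  have main: "\<beta> \<le> (M ^ 4 / e) * (1 - (\<Sum>k<K. a k * radius n ^ (2 * Suc k))) + sqrt 2 / M" for n K
  proof -
    let ?r = "radius n"
    let ?w = "\<lambda>t. of_real ?r * circ t"
    note r = radius(1,2)[of n]
    have cm: "cmod (?w t) < 1" for t using r by (simp add: norm_mult)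
    define b where "b t = (\<integral>y. indicator B y * poisson (?w y) t \<partial>lebesgue_01)" for t
    define s where "s t = cmod (csqrt (cauchy (?w t)))" for t
    note pair = leb.integrable_poisson_pair[OF r B(1)]
    have intb: "integrable lebesgue_01 b"
      unfolding b_def[abs_def] by (rule P.integrable_snd[OF pair])
    have ints: "integrable lebesgue_01 s"
      unfolding s_def[abs_def] by (intro leb.integrable_01 continuous_intros integral_sqrt_cauchy_le r)
    have intd: "integrable lebesgue_01 (\<lambda>t. defect (?w t))"
      by (intro leb.integrable_01 continuous_on_circle_defect r)
    have "(\<integral>t. b t \<partial>lebesgue_01) = (\<integral>y. (\<integral>t. indicator B y
        * poisson (?w y) t \<partial>lebesgue_01) \<partial>lebesgue_01)"
      unfolding b_def by (rule P.Fubini_integral[OF pair])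
    also have "\<dots> = \<beta>"
      using Bs by (simp add: integral_poisson[OF r] \<beta>_def)
    finally have b_mean: "(\<integral>t. b t \<partial>lebesgue_01) = \<beta>" .
    have b1: "b t \<le> 1" for t
    proof -
      have "b t \<le> (\<integral>y. poisson (?w t) y \<partial>lebesgue_01)"
        unfolding b_def poisson_sym[of _ _ t]
        by (intro Bochner_Integration.integral_mono' leb.integrable_01 continuous_on_poisson cm)
           (auto simp: indicator_def poisson_nonneg[OF cm])
      then show ?thesis using integral_poisson[OF r] by simp
    qed
    have be: "e * b t \<le> defect (?w t) * s t ^ 4" for t
    proof -
      have "e * b t \<le> (\<integral>y. poisson (?w t) y \<partial>\<mu>)"
        unfolding b_def poisson_sym[of _ _ t]
        by (intro integral_le_of_lebesgue_part e B le continuous_on_poisson cm poisson_nonneg)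
      also have "\<dots> = defect (?w t) * (cmod (cauchy (?w t)))\<^sup>2" by (rule poisson_eq_defect[OF cm])
      also have "cmod (cauchy (?w t)) = (s t)\<^sup>2"
        unfolding s_def by (metis norm_power power2_csqrt)
      finally show ?thesis by simp
    qed
    have pt: "b t \<le> (M ^ 4 / e) * defect (?w t) + s t / M" for t
    proof (cases "s t \<le> M")
      case True
      have "e * b t \<le> defect (?w t) * M ^ 4"
        using True defect_bounds(1)[OF cm, of t]
        by (intro order_trans[OF be] mult_left_mono power_mono) (auto simp: s_def)
      then have "b t \<le> (M ^ 4 / e) * defect (?w t)" using e by (simp add: field_simps)
      moreover have "0 \<le> s t / M" using M by (simp add: s_def)
      ultimately show ?thesis by linarith
    next
      case False
      then have "1 \<le> s t / M" using M by simp
      moreover have "0 \<le> (M ^ 4 / e) * defect (?w t)"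
        using e M defect_bounds(1)[OF cm, of t] by simp
      ultimately show ?thesis using b1[of t] by linarith
    qed
    have "\<beta> \<le> (\<integral>t. (M ^ 4 / e) * defect (?w t) + s t / M \<partial>lebesgue_01)"
      unfolding b_mean[symmetric] using intb ints intd by (intro integral_mono pt) auto
    also have "\<dots> = (M ^ 4 / e) * (\<integral>t. defect (?w t) \<partial>lebesgue_01) + (\<integral>t. s t \<partial>lebesgue_01) / M"
      using ints intd by simp
    also have "\<dots> \<le> (M ^ 4 / e) * (1 - (\<Sum>k<K. a k * ?r ^ (2 * Suc k))) + sqrt 2 / M"
    proof (intro add_mono mult_left_mono divide_right_mono)
      note d = integral_defect[OF c r]
      have "(\<Sum>k<K. a k * ?r ^ (2 * Suc k)) \<le> 1 - (\<integral>t. defect (?w t) \<partial>lebesgue_01)"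
        using sum_le_suminf[OF sums_summable[OF d], of "{..<K}"] sums_unique[OF d] r
        by (simp add: a_def)
      then show "(\<integral>t. defect (?w t) \<partial>lebesgue_01) \<le> 1 - (\<Sum>k<K. a k * ?r ^ (2 * Suc k))" by simp
      show "(\<integral>t. s t \<partial>lebesgue_01) \<le> sqrt 2" unfolding s_def by (rule integral_sqrt_cauchy_le[OF r])
    qed (use e M in auto)
    finally show ?thesis .
  qed
  \<comment> \<open>First the radius tends to 1 with a fixed partial sum, then the partial sums tend to 1; this order
     replaces an appeal to Abel's limit theorem.\<close>
  have main2: "\<beta> \<le> (M ^ 4 / e) * (1 - (\<Sum>k<K. a k)) + sqrt 2 / M" for K
  proof (rule LIMSEQ_le_const)
    have "(\<lambda>n. (M ^ 4 / e) * (1 - (\<Sum>k<K. a k * radius n ^ (2 * Suc k))) + sqrt 2 / M)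
       \<longlonglongrightarrow> (M ^ 4 / e) * (1 - (\<Sum>k<K. a k * 1 ^ (2 * Suc k))) + sqrt 2 / M"
      by (intro tendsto_intros radius)
    then show "(\<lambda>n. (M ^ 4 / e) * (1 - (\<Sum>k<K. a k * radius n ^ (2 * Suc k))) + sqrt 2 / M)
       \<longlonglongrightarrow> (M ^ 4 / e) * (1 - (\<Sum>k<K. a k)) + sqrt 2 / M" by simp
  qed (use main in auto)
  have "\<beta> \<le> sqrt 2 / M"
  proof (rule LIMSEQ_le_const)
    have "(\<lambda>K. (M ^ 4 / e) * (1 - (\<Sum>k<K. a k)) + sqrt 2 / M) \<longlonglongrightarrow> (M ^ 4 / e) * (1 - 1) + sqrt 2 / M"
      using sums1 unfolding a_def sums_def by (intro tendsto_intros)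
    then show "(\<lambda>K. (M ^ 4 / e) * (1 - (\<Sum>k<K. a k)) + sqrt 2 / M) \<longlonglongrightarrow> sqrt 2 / M" by simp
  qed (use main2 in auto)
  also have "sqrt 2 / M = \<beta> * (sqrt 2 / 2)" by (simp add: M_def)
  also have "\<dots> < \<beta> * 1"
    using \<beta> sqrt2_less_2 by (intro mult_strict_left_mono) auto
  finally show False by simp
qed

end

end

section \<open>Herglotz representation of positive definite sequences\<close>

text \<open>
  The sequence is given on the non-negative integers only and is extended to the negative ones
  by conjugation; the entry (j, k) is the value at k - j.
\<close>

definition toeplitz :: "(nat \<Rightarrow> complex) \<Rightarrow> nat \<Rightarrow> nat \<Rightarrow> complex" where
  "toeplitz \<gamma> j k = (if j \<le> k then \<gamma> (k - j) else cnj (\<gamma> (j - k)))"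

definition positive_definite_seq :: "(nat \<Rightarrow> complex) \<Rightarrow> bool" where
  "positive_definite_seq \<gamma> \<longleftrightarrow>
     (\<forall>N \<alpha>. (\<Sum>j<N. \<Sum>k<N. \<alpha> j * cnj (\<alpha> k) * toeplitz \<gamma> j k) \<in> \<real>\<^sub>\<ge>\<^sub>0)"

text \<open>
  The N-th Fejer mean of the Fourier series with coefficients \<gamma>, written as a value of
  the quadratic form of the Toeplitz matrix so that its positivity is evident.
\<close>

definition fejer :: "(nat \<Rightarrow> complex) \<Rightarrow> nat \<Rightarrow> real \<Rightarrow> complex" where
  "fejer \<gamma> N y = (\<Sum>j<N. \<Sum>k<N. cnj (circ y) ^ j * cnj (cnj (circ y) ^ k) * toeplitz \<gamma> j k) / of_nat N"

lemma continuous_on_fejer: "continuous_on A (fejer \<gamma> N)"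
  unfolding fejer_def[abs_def] divide_inverse by (intro continuous_intros)

lemma fejer_nonneg:
  assumes "positive_definite_seq \<gamma>"
  shows "0 \<le> Re (fejer \<gamma> N y)" "of_real (Re (fejer \<gamma> N y)) = fejer \<gamma> N y"
proof -
  have "(\<Sum>j<N. \<Sum>k<N. cnj (circ y) ^ j * cnj (cnj (circ y) ^ k) * toeplitz \<gamma> j k) \<in> \<real>\<^sub>\<ge>\<^sub>0"
    using assms unfolding positive_definite_seq_def by blast
  then obtain x where "x \<ge> 0" "(\<Sum>j<N. \<Sum>k<N. cnj (circ y) ^ j * cnj (cnj (circ y) ^ k)
      * toeplitz \<gamma> j k) = of_real x"
    by (elim nonneg_Reals_cases)
  then have "fejer \<gamma> N y = of_real (x / real N)" "x / real N \<ge> 0" by (auto simp: fejer_def)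
  then show "0 \<le> Re (fejer \<gamma> N y)" "of_real (Re (fejer \<gamma> N y)) = fejer \<gamma> N y" by simp_all
qed

lemma integral_fejer:
  assumes "n \<le> N"
  shows "(\<integral>y. fejer \<gamma> N y * cnj (circ y) ^ n \<partial>lebesgue_01) = of_nat (N - n) / of_nat N * \<gamma> n"
proof -
  have "(\<integral>y. fejer \<gamma> N y * cnj (circ y) ^ n \<partial>lebesgue_01) =
    (\<integral>y. (\<Sum>j<N. \<Sum>k<N. toeplitz \<gamma> j k / of_nat N * (circ y ^ k * cnj (circ y) ^ (j + n))) \<partial>lebesgue_01)"
    by (rule Bochner_Integration.integral_cong)
       (simp_all add: fejer_def sum_divide_distrib sum_distrib_right sum_distrib_left power_add mult_ac)
  also have "\<dots> = (\<Sum>j<N. \<Sum>k<N. toeplitz \<gamma> j k / of_nat N * (\<integral>y. circ y ^ k * cnj (circ y) ^ (j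
      + n) \<partial>lebesgue_01))"
  proof -
    have i: "integrable lebesgue_01 (\<lambda>y. toeplitz \<gamma> j k / of_nat N * (circ y ^ k * cnj (circ y) ^ (j
        + n)))" for j k
      by (intro leb.integrable_01 continuous_intros)
    then have "integrable lebesgue_01 (\<lambda>y. \<Sum>k<N. toeplitz \<gamma> j k / of_nat N * (circ y ^ k
        * cnj (circ y) ^ (j + n)))" for j
      by (intro Bochner_Integration.integrable_sum)
    with i show ?thesis
      by (simp only: Bochner_Integration.integral_sum integral_mult_right_zero)
  qed
  also have "\<dots> = (\<Sum>j<N. if j + n < N then \<gamma> n / of_nat N else 0)"
  proof (rule sum.cong[OF refl])
    fix j
    have "(\<Sum>k<N. toeplitz \<gamma> j k / of_nat N * (\<integral>y. circ y ^ k * cnj (circ y) ^ (j + n) \<partial>lebesgue_01)) =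
      (\<Sum>k<N. if k = j + n then toeplitz \<gamma> j k / of_nat N else 0)"
      unfolding lebesgue_orthonormal by (intro sum.cong) auto
    also have "\<dots> = (if j + n < N then \<gamma> n / of_nat N else 0)"
      by (simp add: sum.delta toeplitz_def)
    finally show "(\<Sum>k<N. toeplitz \<gamma> j k / of_nat N * (\<integral>y. circ y ^ k * cnj (circ y) ^ (j
        + n) \<partial>lebesgue_01)) =
      (if j + n < N then \<gamma> n / of_nat N else 0)" .
  qed
  also have "\<dots> = (\<Sum>j | j < N \<and> j + n < N. \<gamma> n / of_nat N)"
    by (subst sum.inter_filter[symmetric]) (auto intro: sum.cong)
  also have "{j. j < N \<and> j + n < N} = {..<N - n}" by auto
  finally show ?thesis by simp
qed

text \<open>
  The Fejer means are densities of probability measures whose Fourier coefficients converge to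
  \<gamma>. All of them live on [0,1), so Helly's selection theorem provides a weak limit on the
  real line. The limit may charge the point 1; taking fractional parts moves it to [0,1) without
  changing any Fourier coefficient.
\<close>

theorem herglotz:
  assumes \<gamma>0: "\<gamma> 0 = 1" and pd: "positive_definite_seq \<gamma>"
  obtains \<mu> where "prob_measure_01 \<mu>" "\<And>n. fourier_coeff \<mu> n = \<gamma> n"
proof -
  define g where "g N y = Re (fejer \<gamma> (Suc N) y)" for N y
  have cont_g: "continuous_on UNIV (g N)" for N
    unfolding g_def[abs_def] by (intro continuous_intros continuous_on_fejer)
  have g0: "0 \<le> g N y" and gF: "complex_of_real (g N y) = fejer \<gamma> (Suc N) y" for N y
    unfolding g_def using fejer_nonneg[OF pd] by auto
  have [measurable]: "g N \<in> borel_measurable lebesgue_01" for N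
    by (intro leb.measurable_01_continuous cont_g)
  have id01: "(\<lambda>y. y) \<in> borel_measurable lebesgue_01"
    by (intro leb.measurable_01_continuous continuous_intros)
  define D where "D N = density lebesgue_01 (\<lambda>y. ennreal (g N y))" for N
  have idD [measurable]: "(\<lambda>y. y) \<in> borel_measurable (D N)" for N
    unfolding D_def using id01 by simp
  have g1: "(\<integral>y. g N y \<partial>lebesgue_01) = 1" for N
  proof -
    have "complex_of_real (\<integral>y. g N y \<partial>lebesgue_01)
        = (\<integral>y. fejer \<gamma> (Suc N) y * cnj (circ y) ^ 0 \<partial>lebesgue_01)"
      by (simp add: gF flip: integral_complex_of_real)
    also have "\<dots> = 1" by (subst integral_fejer) (auto simp: \<gamma>0 simp del: of_nat_Suc)
    finally show ?thesis by (simp only: of_real_eq_1_iff)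
  qed
  have prob_D: "prob_space (D N)" for N
  proof (rule prob_spaceI)
    have "emeasure (D N) (space (D N)) = (\<integral>\<^sup>+y. ennreal (g N y) \<partial>lebesgue_01)"
      unfolding D_def by (subst emeasure_density) (auto intro!: nn_integral_cong)
    also have "\<dots> = ennreal (\<integral>y. g N y \<partial>lebesgue_01)"
      by (intro nn_integral_eq_integral leb.integrable_01 cont_g) (simp add: g0)
    finally show "emeasure (D N) (space (D N)) = 1" by (simp add: g1)
  qed
  define \<nu> where "\<nu> N = distr (D N) borel (\<lambda>y. y)" for N
  have rd: "real_distribution (\<nu> N)" for N
    unfolding \<nu>_def by (intro prob_space.real_distribution_distr prob_D idD)
  have int_\<nu>: "(\<integral>y. cnj (circ y) ^ n \<partial>\<nu> N) = of_nat (Suc N - n) / of_nat (Suc N) * \<gamma> n" if "n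
      \<le> Suc N" for n N
  proof -
    have [measurable]: "(\<lambda>y. cnj (circ y) ^ n) \<in> borel_measurable borel"
      by (intro borel_measurable_continuous_onI continuous_intros)
    have [measurable]: "(\<lambda>y. cnj (circ y) ^ n) \<in> borel_measurable lebesgue_01"
      by (intro leb.measurable_01_continuous continuous_intros)
    have "(\<integral>y. cnj (circ y) ^ n \<partial>\<nu> N) = (\<integral>y. cnj (circ y) ^ n \<partial>D N)"
      unfolding \<nu>_def by (rule integral_distr) measurable
    also have "\<dots> = (\<integral>y. g N y *\<^sub>R cnj (circ y) ^ n \<partial>lebesgue_01)"
      unfolding D_def by (rule integral_density) (auto simp: g0)
    also have "\<dots> = (\<integral>y. fejer \<gamma> (Suc N) y * cnj (circ y) ^ n \<partial>lebesgue_01)"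
      by (simp add: scaleR_conv_of_real gF)
    finally show ?thesis using integral_fejer[OF that] by simp
  qed
  have "tight \<nu>"
    unfolding tight_def
  proof (intro conjI allI impI rd)
    fix \<epsilon> :: real assume \<epsilon>: "\<epsilon> > 0"
    have "measure (\<nu> N) {-1<..1} = 1" for N
    proof -
      interpret D: prob_space "D N" by (rule prob_D)
      have "measure (\<nu> N) {-1<..1} = measure (D N) ((\<lambda>y. y) -` {-1<..1} \<inter> space (D N))"
        unfolding \<nu>_def by (rule measure_distr) auto
      also have "(\<lambda>y. y) -` {-1<..1} \<inter> space (D N) = space (D N)"
        by (auto simp: D_def leb.space_01)
      finally show ?thesis by (simp add: D.prob_space)
    qed
    then show "\<exists>a b. a < b \<and> (\<forall>N. 1 - \<epsilon> < measure (\<nu> N) {a<..b})"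
      using \<epsilon> by (intro exI[of _ "-1"] exI[of _ 1]) auto
  qed
  then obtain s M where s: "strict_mono (s :: nat \<Rightarrow> nat)" and M: "real_distribution M"
    and wc: "weak_conv_m (\<nu> \<circ> id \<circ> s) M"
    using tight_imp_convergent_subsubsequence[of \<nu> id] by (auto simp: strict_mono_id)
  interpret M: real_distribution M by (rule M)
  have int_M: "(\<integral>y. cnj (circ y) ^ n \<partial>M) = \<gamma> n" for n
  proof -
    have "(\<lambda>N. \<integral>y. cnj (circ y) ^ n \<partial>((\<nu> \<circ> id \<circ> s) N)) \<longlonglongrightarrow> (\<integral>y. cnj (circ y) ^ n \<partial>M)"
    proof (rule weak_conv_imp_integral_bdd_continuous_conv[OF _ M wc])
      show "real_distribution ((\<nu> \<circ> id \<circ> s) N)" for N using rd by simp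
      have "continuous_on UNIV (\<lambda>y. cnj (circ y) ^ n)" by (intro continuous_intros)
      then show "isCont (\<lambda>y. cnj (circ y) ^ n) y" for y
        by (simp add: continuous_on_eq_continuous_at)
      show "norm (cnj (circ y) ^ n) \<le> 1" for y by (simp add: norm_power)
    qed
    moreover have "(\<lambda>N. \<integral>y. cnj (circ y) ^ n \<partial>((\<nu> \<circ> id \<circ> s) N)) \<longlonglongrightarrow> \<gamma> n"
    proof -
      have lim: "(\<lambda>N. complex_of_real (1 - real n / real (Suc (s N))) * \<gamma> n) \<longlonglongrightarrow> of_real (1 - 0) * \<gamma> n"
      proof (intro tendsto_intros)
        have "(\<lambda>N. real n / real (Suc N)) \<longlonglongrightarrow> 0"
          using tendsto_mult_right_zero[OF LIMSEQ_inverse_real_of_nat, of "real n"] by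
              (simp add: divide_inverse)
        then show "(\<lambda>N. real n / real (Suc (s N))) \<longlonglongrightarrow> 0"
          using LIMSEQ_subseq_LIMSEQ[OF _ s] by (force simp: o_def)
      qed
      have "\<forall>\<^sub>F N in sequentially. complex_of_real (1 - real n / real (Suc (s N))) * \<gamma> n
          = (\<integral>y. cnj (circ y) ^ n \<partial>((\<nu> \<circ> id \<circ> s) N))"
        using eventually_ge_at_top[of n]
      proof eventually_elim
        case (elim N)
        have ns: "n \<le> Suc (s N)" using elim seq_suble[OF s, of N] by linarith
        have "of_nat (Suc (s N) - n) / of_nat (Suc (s N))
            = complex_of_real (1 - real n / real (Suc (s N)))"
          using ns by (simp add: of_nat_diff diff_divide_distrib del: of_nat_Suc)
        then show ?case using int_\<nu>[OF ns] by (simp del: of_nat_Suc)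
      qed
      then show ?thesis using lim by (simp add: tendsto_cong[symmetric])
    qed
    ultimately show ?thesis using LIMSEQ_unique by blast
  qed
  have "(\<lambda>x::real. x - real_of_int \<lfloor>x\<rfloor>) \<in> borel_measurable borel"
    by (intro borel_measurable_diff borel_measurable_real_floor) simp
  then have frac_meas: "frac \<in> measurable M (restrict_space borel {0..<1})"
    unfolding frac_def[abs_def, symmetric]
    by (intro measurable_restrict_space2) (auto simp: frac_lt_1)
  define \<mu> where "\<mu> = distr M (restrict_space borel {0..<1}) frac"
  have "prob_measure_01 \<mu>"
    unfolding prob_measure_01_def \<mu>_def using frac_meas by (simp add: M.prob_space_distr)
  moreover have "fourier_coeff \<mu> n = \<gamma> n" for n
  proof -
    have per: "circ (frac y) = circ y" for y
    proof -
      have "circ y = circ (frac y) * cis (2 * pi * of_int \<lfloor>y\<rfloor>)"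
        by (simp add: circ_def cis_mult frac_def algebra_simps)
      then show ?thesis by (simp add: cis_multiple_2pi)
    qed
    have "fourier_coeff \<mu> n = (\<integral>y. cnj (circ (frac y)) ^ n \<partial>M)"
      unfolding fourier_coeff_circ \<mu>_def
      by (rule integral_distr[OF frac_meas])
         (intro measurable_restrict_space1 borel_measurable_continuous_onI continuous_intros)
    then show ?thesis by (simp add: per int_M)
  qed
  ultimately show thesis by (rule that)
qed

section \<open>Taylor coefficients of inner functions\<close>

lemma powser_unique_on_disk:
  fixes a b :: "nat \<Rightarrow> complex"
  assumes a: "\<forall>w\<in>ball 0 1. (\<lambda>n. a n * w ^ n) sums f w"
    and b: "\<forall>w\<in>ball 0 1. (\<lambda>n. b n * w ^ n) sums f w"
  shows "a = b"
proof -
  have coeff: "(\<integral>t. f (of_real (1 / 2) * circ t) * cnj (circ t) ^ m \<partial>lebesgue_01)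
      = d m * of_real (1 / 2) ^ m"
    if d: "\<forall>w\<in>ball 0 1. (\<lambda>n. d n * w ^ n) sums f w" for d m
  proof -
    have "summable (\<lambda>n. cmod (d n * of_real (1 / 2) ^ n))"
      by (rule powser_insidea[of d "of_real (3 / 4)"])
         (use d in \<open>auto intro: sums_summable simp: norm_divide\<close>)
    then have s: "summable (\<lambda>n. cmod (d n) * (1 / 2) ^ n)"
      by (simp only: norm_mult norm_power norm_of_real) simp
    have "f (of_real (1 / 2) * circ t) = (\<Sum>n. d n * (of_real (1 / 2) * circ t) ^ n)" for t
      using d by (intro sums_unique) (simp add: norm_mult norm_divide)
    then show ?thesis using circle_coefficient[OF s] by simp
  qed
  have "a m * of_real (1 / 2) ^ m = b m * complex_of_real (1 / 2) ^ m" for m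
    using coeff[OF a, of m] coeff[OF b, of m] by simp
  then show ?thesis by (auto simp: fun_eq_iff)
qed

lemma power_series_coeffs_eq:
  assumes "\<forall>w\<in>ball 0 1. (\<lambda>n. a n * w ^ n) sums f w"
  shows "power_series_coeffs f = a"
  unfolding power_series_coeffs_def
  by (rule the_equality) (use assms powser_unique_on_disk in blast)+

text \<open>
  Multiplication with an inner function preserves the Hardy norm of the constant function 1.
\<close>

lemma inner_function_coeffs:
  assumes b: "inner_function b" and d: "\<forall>w\<in>ball 0 1. (\<lambda>n. d n * w ^ n) sums b w"
  shows "(\<lambda>n. (cmod (d n))\<^sup>2) sums 1"
proof -
  define \<delta> where "\<delta> n = (if n = 0 then 1 else 0 :: complex)" for n :: nat
  have one: "\<forall>w\<in>ball 0 1. (\<lambda>n. \<delta> n * w ^ n) sums 1"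
  proof
    fix w :: complex
    have "(\<lambda>n. \<delta> n * w ^ n) = (\<lambda>n. if n = 0 then 1 else 0)" by (auto simp: \<delta>_def)
    then show "(\<lambda>n. \<delta> n * w ^ n) sums 1" using sums_single[of 0 "\<lambda>_. 1::complex"] by simp
  qed
  have \<delta>1: "(\<lambda>n. (cmod (\<delta> n))\<^sup>2) sums 1"
  proof -
    have "(\<lambda>n. (cmod (\<delta> n))\<^sup>2) = (\<lambda>n. if n = 0 then 1 else 0)" by (auto simp: \<delta>_def)
    then show ?thesis using sums_single[of 0 "\<lambda>_. 1::real"] by simp
  qed
  have "(\<lambda>w. 1) \<in> hardy_H2"
    unfolding hardy_H2_def using one sums_summable[OF \<delta>1] by auto
  then have mem: "(\<lambda>w. b w * 1) \<in> hardy_H2" and nrm: "hardy_norm (\<lambda>w. b w * 1) = hardy_norm (\<lambda>w. 1)"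
    using b[unfolded inner_function_def, THEN conjunct2, THEN conjunct2, THEN bspec[of _ _ "\<lambda>w. 1"]]
        by simp_all
  have "summable (\<lambda>n. (cmod (d n))\<^sup>2)"
  proof -
    obtain a where a: "summable (\<lambda>n. (cmod (a n))\<^sup>2)" "\<forall>w\<in>ball 0 1. (\<lambda>n. a n * w ^ n) sums (b w * 1)"
      using mem unfolding hardy_H2_def by blast
    have "a = d" by (rule powser_unique_on_disk[OF a(2)]) (use d in simp)
    with a show ?thesis by simp
  qed
  moreover have "(\<Sum>n. (cmod (d n))\<^sup>2) = 1"
  proof -
    have "hardy_norm (\<lambda>w. b w * 1) = sqrt (\<Sum>n. (cmod (d n))\<^sup>2)"
      unfolding hardy_norm_def using power_series_coeffs_eq[OF d] by simp
    moreover have "hardy_norm (\<lambda>w. 1) = 1"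
      unfolding hardy_norm_def power_series_coeffs_eq[OF one] using sums_unique[OF \<delta>1] by simp
    ultimately show ?thesis using nrm by simp
  qed
  ultimately show ?thesis using sums_iff by blast
qed

section \<open>Hilbert modules over an algebra of continuous functions\<close>

text \<open>
  Dini's theorem: by monotonicity the sets on which f n is smaller than \<epsilon> increase with
  n, and they form an open cover.
\<close>

lemma dini_to_0:
  fixes f :: "nat \<Rightarrow> 'x \<Rightarrow> real"
  assumes X: "compact_space X" and cont: "\<And>n. continuous_map X euclideanreal (f n)"
    and dec: "\<And>n x. x \<in> topspace X \<Longrightarrow> f (Suc n) x \<le> f n x"
    and lim: "\<And>x. x \<in> topspace X \<Longrightarrow> (\<lambda>n. f n x) \<longlonglongrightarrow> 0"
    and \<epsilon>: "\<epsilon> > 0"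
  shows "\<exists>N. \<forall>n\<ge>N. \<forall>x\<in>topspace X. f n x < \<epsilon>"
proof -
  define V where "V n = {x \<in> topspace X. f n x \<in> {..<\<epsilon>}}" for n
  have V: "openin X (V n)" for n
    unfolding V_def by (rule openin_continuous_map_preimage[OF cont]) (simp add: open_openin[symmetric])
  have mono: "f n x \<le> f m x" if "m \<le> n" "x \<in> topspace X" for m n x
    using that(1) by (induction rule: dec_induct) (use dec[OF that(2)] order_trans in \<open>auto intro:
        order_trans\<close>)
  have "topspace X \<subseteq> \<Union>(range V)"
  proof
    fix x assume x: "x \<in> topspace X"
    then have "\<forall>\<^sub>F n in sequentially. f n x < \<epsilon>" by (intro order_tendstoD(2)[OF lim \<epsilon>])
    then obtain n where "f n x < \<epsilon>" by (auto simp: eventually_sequentially)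
    with x show "x \<in> \<Union>(range V)" by (auto simp: V_def)
  qed
  then obtain F where F: "finite F" "F \<subseteq> range V" "topspace X \<subseteq> \<Union>F"
    using X V unfolding compact_space_alt by (metis (no_types, lifting) rangeE)
  obtain I where I: "finite I" "F = V ` I"
    using finite_subset_image[OF F(1,2)] by auto
  have "f n x < \<epsilon>" if n: "n \<ge> Max (insert 0 I)" and x: "x \<in> topspace X" for n x
  proof -
    obtain i where i: "i \<in> I" "x \<in> V i" using F(3) I x by auto
    have "i \<le> Max (insert 0 I)" using I i by (intro Max_ge) auto
    then have "f n x \<le> f i x" using n x by (intro mono) auto
    also have "\<dots> < \<epsilon>" using i by (simp add: V_def)
    finally show ?thesis .
  qed
  then show ?thesis by blast
qed

locale gelfand =
  fixes X :: "'x topology"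
    and \<phi> :: "'a::unital_cstar_algebra \<Rightarrow> 'x \<Rightarrow> complex"
  assumes compact_X: "compact_space X"
    and iso: "cstar_iso_CX X \<phi>"
begin

lemma phi_continuous: "continuous_map X euclidean (\<phi> a)"
  and phi_surj: "continuous_map X euclidean f \<Longrightarrow> \<exists>a. \<forall>x\<in>topspace X. \<phi> a x = f x"
  and norm_eq_sup: "norm a = sup_norm X (\<phi> a)"
  using iso by (auto simp: cstar_iso_CX_def)

lemma
  assumes "x \<in> topspace X"
  shows phi_add: "\<phi> (a + b) x = \<phi> a x + \<phi> b x"
    and phi_scaleC: "\<phi> (z *\<^sub>C a) x = z * \<phi> a x"
    and phi_mult: "\<phi> (a * b) x = \<phi> a x * \<phi> b x"
    and phi_one: "\<phi> 1 x = 1"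
    and phi_star: "\<phi> (star a) x = cnj (\<phi> a x)"
  using iso assms by (auto simp: cstar_iso_CX_def)

lemma phi_zero: "x \<in> topspace X \<Longrightarrow> \<phi> 0 x = 0"
  using phi_add[of x 0 0] by simp

lemma phi_diff: "x \<in> topspace X \<Longrightarrow> \<phi> (a - b) x = \<phi> a x - \<phi> b x"
  using phi_add[of x "a - b" b] by simp

lemma phi_minus: "x \<in> topspace X \<Longrightarrow> \<phi> (- a) x = - \<phi> a x"
  using phi_diff[of x 0 a] by (simp add: phi_zero)

lemma phi_sum: "x \<in> topspace X \<Longrightarrow> \<phi> (\<Sum>i\<in>I. f i) x = (\<Sum>i\<in>I. \<phi> (f i) x)"
  by (induction I rule: infinite_finite_induct) (auto simp: phi_zero phi_add)

text \<open>
  The value of a Gelfand transform at a point belongs to the spectrum, since a - \<phi> a x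
  vanishes at x.
\<close>

lemma phi_nonneg:
  assumes a: "cstar_nonneg a" and x: "x \<in> topspace X"
  shows "\<phi> a x \<in> \<real>\<^sub>\<ge>\<^sub>0"
proof -
  have "\<phi> a x \<in> spectrum a"
    unfolding spectrum_def
  proof (intro CollectI notI)
    assume "\<exists>b. b * (a - \<phi> a x *\<^sub>C 1) = 1 \<and> (a - \<phi> a x *\<^sub>C 1) * b = 1"
    then obtain b where "b * (a - \<phi> a x *\<^sub>C 1) = 1" by blast
    then have "\<phi> b x * \<phi> (a - \<phi> a x *\<^sub>C 1) x = 1"
      using phi_mult[OF x] phi_one[OF x] by metis
    then show False by (simp add: phi_diff[OF x] phi_scaleC[OF x] phi_one[OF x])
  qed
  then show ?thesis using a by (auto simp: cstar_nonneg_def)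
qed

lemma norm_le_iff_phi:
  assumes "0 \<le> r"
  shows "norm a \<le> r \<longleftrightarrow> (\<forall>x\<in>topspace X. cmod (\<phi> a x) \<le> r)"
proof -
  have "compactin euclidean (\<phi> a ` topspace X)"
    using compact_X by (intro image_compactin[OF _ phi_continuous]) (simp add: compact_space_def)
  then have "bounded (\<phi> a ` topspace X)"
    by (simp add: compact_imp_bounded)
  then have "bdd_above (insert 0 ((\<lambda>x. cmod (\<phi> a x)) ` topspace X))"
  proof -
    obtain M where "\<And>x. x \<in> topspace X \<Longrightarrow> cmod (\<phi> a x) \<le> M"
      using \<open>bounded (\<phi> a ` topspace X)\<close> by (auto simp: bounded_iff)
    then show ?thesis by (intro bdd_aboveI[of _ "max 0 M"]) force
  qed
  then have "norm a \<le> r \<longleftrightarrow> (\<forall>y\<in>insert 0 ((\<lambda>x. cmod (\<phi> a x)) ` topspace X). y \<le> r)"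
    unfolding norm_eq_sup sup_norm_def by (intro cSup_le_iff) auto
  then show ?thesis using assms by auto
qed

lemma phi_le_norm: "x \<in> topspace X \<Longrightarrow> cmod (\<phi> a x) \<le> norm a"
  using norm_le_iff_phi[of "norm a" a] by simp

end

locale gelfand_module = gelfand X \<phi> + hilbert_module smul ip
  for X :: "'x topology"
    and \<phi> :: "'a::{unital_cstar_algebra, comm_monoid_mult} \<Rightarrow> 'x \<Rightarrow> complex"
    and smul :: "'a \<Rightarrow> 'h::{banach, complex_vector} \<Rightarrow> 'h"
    and ip :: "'h \<Rightarrow> 'h \<Rightarrow> 'a"
begin

text \<open>
  Evaluation at a point x turns the A-valued inner product into a positive semidefinite
  sesquilinear form. Statements about the module norm become statements that are uniform in x.
\<close>

definition form :: "'x \<Rightarrow> 'h \<Rightarrow> 'h \<Rightarrow> complex" where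
  "form x u v = \<phi> (ip u v) x"

lemma smul_zero_left: "smul 0 u = 0"
  using smul_add_left[of 0 0 u] by simp

lemma smul_diff_right: "smul a (u - v) = smul a u - smul a v"
  using smul_add_right[of a "u - v" v] by simp

lemma ip_add_left: "ip (u + v) w = ip u w + ip v w"
  using ip_linear[of 1 u 1 v w] by (simp add: smul_one)

lemma ip_smul_left: "ip (smul a u) w = a * ip u w"
  using ip_linear[of a u 0 u w] by (simp add: smul_zero_left)

lemma ip_diff_left: "ip (u - v) w = ip u w - ip v w"
  using ip_add_left[of "u - v" v w] by simp

context
  fixes x
  assumes x: "x \<in> topspace X"
begin

lemma form_cnj: "form x u v = cnj (form x v u)"
  unfolding form_def by (subst ip_star) (rule phi_star[OF x])

lemma form_add_left: "form x (u + v) w = form x u w + form x v w"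
  by (simp add: form_def ip_add_left phi_add[OF x])

lemma form_diff_left: "form x (u - v) w = form x u w - form x v w"
  by (simp add: form_def ip_diff_left phi_diff[OF x])

lemma form_smul_left: "form x (smul a u) w = \<phi> a x * form x u w"
  by (simp add: form_def ip_smul_left phi_mult[OF x])

lemma form_add_right: "form x w (u + v) = form x w u + form x w v"
  by (metis form_cnj form_add_left complex_cnj_add)

lemma form_diff_right: "form x w (u - v) = form x w u - form x w v"
  by (metis form_cnj form_diff_left complex_cnj_diff)

lemma form_smul_right: "form x w (smul a u) = cnj (\<phi> a x) * form x w u"
  by (metis form_cnj form_smul_left complex_cnj_mult)

lemma form_sum_left: "form x (\<Sum>i\<in>I. f i) w = (\<Sum>i\<in>I. form x (f i) w)"
  using form_diff_left[of 0 0 w]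
  by (induction I rule: infinite_finite_induct) (auto simp: form_add_left)

lemma form_sum_right: "form x w (\<Sum>i\<in>I. f i) = (\<Sum>i\<in>I. form x w (f i))"
  using form_diff_right[of w 0 0]
  by (induction I rule: infinite_finite_induct) (auto simp: form_add_right)

lemma form_nonneg: "form x u u \<in> \<real>\<^sub>\<ge>\<^sub>0"
  unfolding form_def by (rule phi_nonneg[OF ip_nonneg x])

lemma form_self: "form x u u = of_real (Re (form x u u))" "0 \<le> Re (form x u u)"
  "cmod (form x u u) = Re (form x u u)"
  using form_nonneg[of u] by (auto elim!: nonneg_Reals_cases)

lemma form_le_norm: "Re (form x u u) \<le> (norm u)\<^sup>2"
  using phi_le_norm[OF x, of "ip u u"] form_self(3)[of u] by (simp add: norm_eq form_def)

end

lemma norm_le_iff_form: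
  assumes "0 \<le> r"
  shows "norm u \<le> r \<longleftrightarrow> (\<forall>x\<in>topspace X. Re (form x u u) \<le> r\<^sup>2)"
proof -
  have "norm u \<le> r \<longleftrightarrow> norm (ip u u) \<le> r\<^sup>2"
    using assms real_sqrt_le_iff[of "norm (ip u u)" "r\<^sup>2"] by (simp add: norm_eq)
  also have "\<dots> \<longleftrightarrow> (\<forall>x\<in>topspace X. cmod (form x u u) \<le> r\<^sup>2)"
    unfolding form_def by (rule norm_le_iff_phi) simp
  finally show ?thesis by (simp add: form_self(3))
qed

lemma norm_smul_le: "norm (smul a u) \<le> norm a * norm u"
proof (subst norm_le_iff_form, simp, intro ballI)
  fix x assume x: "x \<in> topspace X"
  have "Re (form x (smul a u) (smul a u)) = cmod (form x (smul a u) (smul a u))"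
    using form_self(3)[OF x] by simp
  also have "\<dots> = (cmod (\<phi> a x))\<^sup>2 * Re (form x u u)"
    by (simp add: form_smul_left[OF x] form_smul_right[OF x] norm_mult form_self(3)[OF x]
        power2_eq_square)
  also have "\<dots> \<le> (norm a)\<^sup>2 * (norm u)\<^sup>2"
    using phi_le_norm[OF x, of a] form_le_norm[OF x, of u] form_self(2)[OF x, of u]
    by (intro mult_mono power_mono) auto
  finally show "Re (form x (smul a u) (smul a u)) \<le> (norm a * norm u)\<^sup>2"
    by (simp add: power_mult_distrib)
qed

lemma continuous_form: "continuous_map X euclideanreal (\<lambda>x. Re (form x u u))"
  unfolding form_def
  using continuous_map_compose[OF phi_continuous, of euclideanreal Re "ip u u"]
  by (simp add: o_def continuous_on_Re)

text \<open>
  The norm only sees the supremum over X of the forms, but the inequality is assumed for all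
  multiples by elements of the algebra, and these act as weights. If the form of u exceeded that
  of v by \<epsilon> at x0, the weight 1/(\<langle>v,v\<rangle> + \<epsilon>) would give the
  weighted form of u the value 1 at x0, while the weighted form of v stays uniformly below 1.
\<close>

lemma form_mono_of_norm_mono:
  assumes le: "\<And>a. norm (smul a u) \<le> norm (smul a v)" and x0: "x0 \<in> topspace X"
  shows "Re (form x0 u u) \<le> Re (form x0 v v)"
proof (rule ccontr)
  assume neg: "\<not> ?thesis"
  define \<epsilon> where "\<epsilon> = Re (form x0 u u) - Re (form x0 v v)"
  have \<epsilon>: "\<epsilon> > 0" using neg by (simp add: \<epsilon>_def)
  \<comment> \<open>The maximum only serves to make k continuous on the whole plane; the forms are non-negative.\<close>
  define k :: "complex \<Rightarrow> complex" where "k z = of_real (1 / sqrt (max 0 (Re z) + \<epsilon>))" for z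
  have nz: "max 0 (Re z) + \<epsilon> \<noteq> 0" for z using \<epsilon> by linarith
  have "continuous_on UNIV (\<lambda>z. complex_of_real (1 / sqrt (max 0 (Re z) + \<epsilon>)))"
    by (intro continuous_intros) (simp_all add: nz)
  then have "continuous_on UNIV k"
    by (simp only: k_def[abs_def])
  then have "continuous_map X euclidean (k \<circ> \<phi> (ip v v))"
    by (intro continuous_map_compose[OF phi_continuous]) simp
  then obtain a where a: "\<And>x. x \<in> topspace X \<Longrightarrow> \<phi> a x = k (form x v v)"
    using phi_surj unfolding form_def o_def by blast
  have eq: "Re (form x (smul a w) (smul a w)) = Re (form x w w) / (Re (form x v v) + \<epsilon>)"
    if x: "x \<in> topspace X" for x w
  proof -
    have "form x (smul a w) (smul a w) = k (form x v v) * (cnj (k (form x v v)) * form x w w)"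
      by (simp add: form_smul_left[OF x] form_smul_right[OF x] a[OF x] mult_ac)
    also have "k (form x v v) * (cnj (k (form x v v)) * form x w w)
        = of_real (1 / (Re (form x v v) + \<epsilon>)) * form x w w"
      using form_self(2)[OF x, of v] \<epsilon> by (simp add: k_def flip: of_real_mult mult.assoc)
    finally show ?thesis by simp
  qed
  define K where "K = (norm v)\<^sup>2"
  have "norm (smul a v) \<le> sqrt (K / (K + \<epsilon>))"
  proof (subst norm_le_iff_form, use \<epsilon> in \<open>simp add: K_def\<close>, intro ballI)
    fix x assume x: "x \<in> topspace X"
    have "Re (form x v v) / (Re (form x v v) + \<epsilon>) \<le> K / (K + \<epsilon>)"
      using form_le_norm[OF x, of v] form_self(2)[OF x, of v] \<epsilon>
      by (simp add: K_def field_simps add_pos_nonneg add_nonneg_pos)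
    then show "Re (form x (smul a v) (smul a v)) \<le> (sqrt (K / (K + \<epsilon>)))\<^sup>2"
      using \<epsilon> by (simp add: eq[OF x] K_def)
  qed
  then have "Re (form x0 (smul a u) (smul a u)) \<le> K / (K + \<epsilon>)"
    using le[of a] form_le_norm[OF x0, of "smul a u"] norm_le_iff_form[of "sqrt (K / (K
        + \<epsilon>))" "smul a u"] x0 \<epsilon>
    by (force simp: K_def)
  moreover have "Re (form x0 (smul a u) (smul a u)) = 1"
    using form_self(2)[OF x0, of v] \<epsilon> by (simp add: eq[OF x0] \<epsilon>_def)
  moreover have "K / (K + \<epsilon>) < 1" using \<epsilon> by (simp add: K_def add_nonneg_pos)
  ultimately show False by linarith
qed

text \<open>
  For commutative algebras this is Blecher's theorem: comparing norms of all multiples gives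
  equality of the forms on the diagonal, and polarization does the rest.
\<close>

lemma isometry_preserves_form:
  assumes lin: "\<And>a b u v. T (smul a u + smul b v) = smul a (T u) + smul b (T v)"
    and isom: "\<And>u. norm (T u) = norm u" and x: "x \<in> topspace X"
  shows "form x (T u) (T v) = form x u v"
proof -
  have smul: "T (smul a u) = smul a (T u)" for a u
    using lin[of a u 0 u] by (simp add: smul_zero_left)
  have add: "T (u + v) = T u + T v" for u v
    using lin[of 1 u 1 v] by (simp add: smul_one)
  have diag: "form x (T u) (T u) = form x u u" for u
  proof -
    have "norm (smul a (T u)) = norm (smul a u)" for a using isom[of "smul a u"] by (simp add: smul)
    then have "Re (form x (T u) (T u)) = Re (form x u u)"
      by (intro antisym form_mono_of_norm_mono x) auto
    then show ?thesis using form_self(1)[OF x] by metis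
  qed
  have re: "Re (form x (T u) (T v)) = Re (form x u v)" for u v
  proof -
    have "Re (form x (w + z) (w + z)) = Re (form x w w) + Re (form x z z) + 2 * Re (form x w z)" for w z
      using form_cnj[OF x, of z w] by (simp add: form_add_left[OF x] form_add_right[OF x])
    from this[of "T u" "T v"] this[of u v] show ?thesis
      using diag[of "u + v"] diag[of u] diag[of v] by (simp add: add)
  qed
  \<comment> \<open>Real parts are settled; the imaginary part is, up to its sign, the real part after
     multiplication by the imaginary unit.\<close>
  have i: "form x (smul (\<i> *\<^sub>C 1) u) v = \<i> * form x u v" for u v
    by (simp add: form_smul_left[OF x] phi_scaleC[OF x] phi_one[OF x])
  have "Im (form x (T u) (T v)) = Im (form x u v)"
    using re[of "smul (\<i> *\<^sub>C 1) u" v] by (simp add: smul i)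
  with re show ?thesis by (simp add: complex_eq_iff)
qed

end

section \<open>The Kaczmarz process of a stationary sequence\<close>

locale stationary_module = gelfand_module X \<phi> smul ip
  for X :: "'x topology"
    and \<phi> :: "'a::{unital_cstar_algebra, comm_monoid_mult} \<Rightarrow> 'x \<Rightarrow> complex"
    and smul :: "'a \<Rightarrow> 'h::{banach, complex_vector} \<Rightarrow> 'h"
    and ip :: "'h \<Rightarrow> 'h \<Rightarrow> 'a" +
  fixes e :: "nat \<Rightarrow> 'h"
  assumes stat: "stationary smul e" and gen: "generates smul e" and unit: "ip (e 0) (e 0) = 1"
begin

definition gram :: "'x \<Rightarrow> nat \<Rightarrow> complex" where
  "gram x n = \<phi> (ip (e 0) (e n)) x"

text \<open>
  As T preserves the form, the Gram matrix of the sequence at x is a Toeplitz matrix.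
\<close>

lemma form_e:
  assumes x: "x \<in> topspace X"
  shows "form x (e j) (e k) = toeplitz (gram x) j k"
proof -
  obtain T where lin: "\<And>a b u v. T (smul a u + smul b v) = smul a (T u) + smul b (T v)"
    and isom: "\<And>u. norm (T u) = norm u" and T: "\<And>n. (T ^^ n) (e 0) = e n"
    using stat unfolding stationary_def by blast
  have pow: "form x ((T ^^ n) u) ((T ^^ n) v) = form x u v" for n u v
    by (induction n) (simp_all add: isometry_preserves_form[OF lin isom x])
  have le: "form x (e j) (e k) = gram x (k - j)" if "j \<le> k" for j k
  proof -
    have "(T ^^ j) (e (k - j)) = (T ^^ j) ((T ^^ (k - j)) (e 0))" by (simp only: T)
    also have "\<dots> = (T ^^ (j + (k - j))) (e 0)" by (simp only: funpow_add o_apply)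
    also have "\<dots> = e k" using that by (simp add: T)
    finally have "e k = (T ^^ j) (e (k - j))" ..
    then show ?thesis using pow[of j "e 0" "e (k - j)"] T[of j] by (simp add: gram_def form_def)
  qed
  show ?thesis
  proof (cases "j \<le> k")
    case False
    then show ?thesis using le[of k j] form_cnj[OF x, of "e j" "e k"] by (simp add: toeplitz_def)
  qed (simp add: le toeplitz_def)
qed

lemma gram_0: "x \<in> topspace X \<Longrightarrow> gram x 0 = 1"
  by (simp add: gram_def unit phi_one)

lemma form_e_self: "x \<in> topspace X \<Longrightarrow> form x (e n) (e n) = 1"
  by (simp add: form_e toeplitz_def gram_0)

lemma ip_e_self: "ip (e n) (e n) = 1"
proof -
  have "\<forall>x\<in>topspace X. \<phi> (ip (e n) (e n)) x = \<phi> 1 x"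
    using form_e_self[of _ n] by (simp add: form_def phi_one)
  then show ?thesis using iso unfolding cstar_iso_CX_def by blast
qed

lemma gram_positive_definite:
  assumes x: "x \<in> topspace X"
  shows "positive_definite_seq (gram x)"
  unfolding positive_definite_seq_def
proof (intro allI)
  fix N and \<alpha> :: "nat \<Rightarrow> complex"
  define v where "v = (\<Sum>j<N. smul (\<alpha> j *\<^sub>C 1) (e j))"
  have "form x v v = (\<Sum>k<N. \<Sum>j<N. \<alpha> j * cnj (\<alpha> k) * toeplitz (gram x) j k)"
    by (simp add: v_def form_sum_left[OF x] form_sum_right[OF x] form_smul_left[OF x]
        form_smul_right[OF x] phi_scaleC[OF x] phi_one[OF x] form_e[OF x] mult_ac sum_distrib_left)
  also have "\<dots> = (\<Sum>j<N. \<Sum>k<N. \<alpha> j * cnj (\<alpha> k) * toeplitz (gram x) j k)" by (rule sum.swap)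
  finally have "form x v v = (\<Sum>j<N. \<Sum>k<N. \<alpha> j * cnj (\<alpha> k) * toeplitz (gram x) j k)" .
  then show "(\<Sum>j<N. \<Sum>k<N. \<alpha> j * cnj (\<alpha> k) * toeplitz (gram x) j k) \<in> \<real>\<^sub>\<ge>\<^sub>0"
    using form_nonneg[OF x, of v] by simp
qed

lemma gram_measure:
  assumes x: "x \<in> topspace X"
  obtains \<mu> where "prob_measure_01 \<mu>" "\<And>n. fourier_coeff \<mu> n = gram x n"
  using herglotz[OF gram_0[OF x] gram_positive_definite[OF x]] by blast

definition kaczmarz_step :: "nat \<Rightarrow> 'h \<Rightarrow> 'h" where
  "kaczmarz_step n w = w - smul (ip w (e n)) (e n)"

text \<open>
  The index counts the steps already made, so that the error after the step with e n has index
  Suc n and the undisturbed vector has index 0.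
\<close>

primrec kaczmarz_error :: "'h \<Rightarrow> nat \<Rightarrow> 'h" where
  "kaczmarz_error u 0 = u"
| "kaczmarz_error u (Suc n) = kaczmarz_step n (kaczmarz_error u n)"

lemma kaczmarz_error_eq: "kaczmarz_error u (Suc n) = u - effective_approx smul ip e u n"
  by (induction n) (simp_all add: kaczmarz_step_def)

lemma kaczmarz_step_smul: "kaczmarz_step n (smul a w) = smul a (kaczmarz_step n w)"
  by (simp add: kaczmarz_step_def ip_smul_left smul_smul smul_diff_right)

lemma kaczmarz_step_add: "kaczmarz_step n (v + w) = kaczmarz_step n v + kaczmarz_step n w"
  by (simp add: kaczmarz_step_def ip_add_left smul_add_left)

lemma kaczmarz_error_smul: "kaczmarz_error (smul a u) n = smul a (kaczmarz_error u n)"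
  by (induction n) (simp_all add: kaczmarz_step_smul)

lemma kaczmarz_error_add: "kaczmarz_error (u + v) n = kaczmarz_error u n + kaczmarz_error v n"
  by (induction n) (simp_all add: kaczmarz_step_add)

lemma kaczmarz_error_zero: "kaczmarz_error 0 n = 0"
  using kaczmarz_error_add[of 0 0 n] by simp

lemma kaczmarz_error_sum: "kaczmarz_error (\<Sum>i\<in>I. f i) n = (\<Sum>i\<in>I. kaczmarz_error (f i) n)"
  by (induction I rule: infinite_finite_induct) (simp_all add: kaczmarz_error_zero kaczmarz_error_add)

lemma form_kaczmarz_step:
  assumes x: "x \<in> topspace X"
  shows "Re (form x (kaczmarz_step n w) (kaczmarz_step n w))
      = Re (form x w w) - (cmod (form x w (e n)))\<^sup>2"
proof -
  define z where "z = form x w (e n)"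
  have z: "\<phi> (ip w (e n)) x = z" "form x (e n) w = cnj z"
    using form_cnj[OF x, of "e n" w] by (simp_all add: z_def form_def)
  have "form x (kaczmarz_step n w) (kaczmarz_step n w) = form x w w - z * cnj z"
    by (simp add: kaczmarz_step_def form_diff_left[OF x] form_diff_right[OF x] form_smul_left[OF x]
      form_smul_right[OF x] form_e_self[OF x] z z_def[symmetric] algebra_simps)
  then show ?thesis
    by (simp add: z_def[symmetric] complex_mult_cnj cmod_power2)
qed

lemma form_kaczmarz_error_antimono:
  "x \<in> topspace X \<Longrightarrow> Re (form x (kaczmarz_error u (Suc n)) (kaczmarz_error u (Suc n)))
      \<le> Re (form x (kaczmarz_error u n) (kaczmarz_error u n))"
  by (simp add: form_kaczmarz_step)

lemma norm_kaczmarz_error_le: "norm (kaczmarz_error u n) \<le> norm u"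
proof (induction n)
  case (Suc n)
  have "norm (kaczmarz_error u (Suc n)) \<le> norm (kaczmarz_error u n)"
    using form_kaczmarz_error_antimono form_le_norm order_trans
        by (subst norm_le_iff_form) (simp, blast)
  with Suc show ?case by simp
qed simp

text \<open>
  At the point x the vectors e n behave like the powers of z in L^2(\<mu>), where \<mu>
  represents the sequence gram x: if an error w corresponds to the function z^n h, in the sense
  that both have the same inner products with all e k and z^k, then so do the errors after the
  next step. The norms agree because each step removes the square of one of these inner
  products.
\<close>

lemma form_kaczmarz_error_eq_residual:
  assumes x: "x \<in> topspace X" and \<mu>: "measure_01 \<mu>" and fc: "\<And>n. fourier_coeff \<mu> n = gram x n"
  shows "Re (form x (kaczmarz_error (e m) n) (kaczmarz_error (e m) n))
      = measure_01.residual \<mu> (\<lambda>y. circ y ^ m) n"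
proof -
  interpret measure_01 \<mu> by (rule \<mu>)
  define h where "h n = (bshift ^^ n) (\<lambda>y. circ y ^ m)" for n
  have cont: "continuous_on UNIV (h n)" for n
    unfolding h_def by (intro continuous_on_bshift_iter continuous_intros)
  have cont0: "continuous_on UNIV (\<lambda>y. circ y ^ m)" by (intro continuous_intros)
  have cancel: "circ y ^ n * h n y * cnj (circ y) ^ n = h n y" for n y
  proof -
    have "circ y ^ n * h n y * cnj (circ y) ^ n = (circ y * cnj (circ y)) ^ n * h n y"
      by (simp only: power_mult_distrib mult_ac)
    then show ?thesis by simp
  qed
  have toep: "toeplitz (gram x) j k = (\<integral>y. circ y ^ j * cnj (circ y) ^ k \<partial>\<mu>)" for j k
    by (cases "j \<le> k")
       (simp_all add: toeplitz_def circ_power_cnj integral_circ_power fc flip: fourier_coeff_circ)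
  have coeff: "form x (kaczmarz_error (e m) n) (e k)
      = (\<integral>y. circ y ^ n * h n y * cnj (circ y) ^ k \<partial>\<mu>)" for n k
  proof (induction n arbitrary: k)
    case 0
    show ?case by (simp add: h_def form_e[OF x] toep)
  next
    case (Suc n)
    define a where "a = (\<integral>y. h n y \<partial>\<mu>)"
    have a: "form x (kaczmarz_error (e m) n) (e n) = a"
      by (simp only: Suc cancel a_def)
    have "form x (kaczmarz_error (e m) (Suc n)) (e k)
        = (\<integral>y. circ y ^ n * h n y * cnj (circ y) ^ k \<partial>\<mu>) - a * (\<integral>y. circ y ^ n * cnj (circ y) ^ k \<partial>\<mu>)"
      using a by (simp add: kaczmarz_step_def form_diff_left[OF x] form_smul_left[OF x] Suc
          form_e[OF x] toep flip: form_def)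
    also have "\<dots> = (\<integral>y. circ y ^ n * h n y * cnj (circ y) ^ k - a * (circ y ^ n * cnj (circ y) ^ k) \<partial>\<mu>)"
      by (subst Bochner_Integration.integral_diff) (auto intro!: integrable_01 continuous_intros cont)
    also have "\<dots> = (\<integral>y. circ y ^ Suc n * h (Suc n) y * cnj (circ y) ^ k \<partial>\<mu>)"
    proof (rule Bochner_Integration.integral_cong[OF refl])
      fix y
      have "h (Suc n) y = cnj (circ y) * (h n y - a)"
        by (simp add: h_def bshift_def a_def)
      then have "circ y ^ Suc n * h (Suc n) y = circ y ^ n * (circ y * cnj (circ y)) * (h n y - a)"
        by (simp only: power_Suc mult_ac)
      then have step: "circ y ^ Suc n * h (Suc n) y = circ y ^ n * (h n y - a)"
        by (simp only: circ_mult_cnj mult_1_right)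
      show "circ y ^ n * h n y * cnj (circ y) ^ k - a * (circ y ^ n * cnj (circ y) ^ k) =
        circ y ^ Suc n * h (Suc n) y * cnj (circ y) ^ k"
        unfolding step by (simp add: algebra_simps)
    qed
    finally show ?case .
  qed
  show ?thesis
  proof (induction n)
    case 0
    show ?case by (simp add: residual_def form_e_self[OF x] norm_power prob_space)
  next
    case (Suc n)
    have "form x (kaczmarz_error (e m) n) (e n) = (\<integral>y. (bshift ^^ n) (\<lambda>y. circ y ^ m) y \<partial>\<mu>)"
      by (simp only: coeff cancel) (simp only: h_def)
    then show ?case
      using Suc by (simp only: kaczmarz_error.simps form_kaczmarz_step[OF x] residual_Suc[OF cont0])
  qed
qed

text \<open>
  The forms of the errors are continuous in x and decrease from step to step, so by Dini's
  theorem pointwise convergence to 0 is uniform, which means convergence in norm.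
\<close>

lemma kaczmarz_error_tendsto_0_iff:
  "kaczmarz_error u \<longlonglongrightarrow> 0 \<longleftrightarrow> (\<forall>x\<in>topspace X. (\<lambda>n. Re (form x (kaczmarz_error u n) (kaczmarz_error u
      n))) \<longlonglongrightarrow> 0)"
proof
  assume *: "kaczmarz_error u \<longlonglongrightarrow> 0"
  show "\<forall>x\<in>topspace X. (\<lambda>n. Re (form x (kaczmarz_error u n) (kaczmarz_error u n))) \<longlonglongrightarrow> 0"
  proof
    fix x assume x: "x \<in> topspace X"
    have "(\<lambda>n. (norm (kaczmarz_error u n))\<^sup>2) \<longlonglongrightarrow> (norm (0::'h))\<^sup>2" by (intro tendsto_intros *)
    then have lim: "(\<lambda>n. (norm (kaczmarz_error u n))\<^sup>2) \<longlonglongrightarrow> 0" by simp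
    show "(\<lambda>n. Re (form x (kaczmarz_error u n) (kaczmarz_error u n))) \<longlonglongrightarrow> 0"
      by (rule tendsto_sandwich[OF _ _ tendsto_const lim])
         (simp_all add: form_le_norm[OF x] form_self(2)[OF x])
  qed
next
  assume lim: "\<forall>x\<in>topspace X. (\<lambda>n. Re (form x (kaczmarz_error u n) (kaczmarz_error u n))) \<longlonglongrightarrow> 0"
  show "kaczmarz_error u \<longlonglongrightarrow> 0"
  proof (rule LIMSEQ_I)
    fix r :: real assume r: "0 < r"
    then have "(r / 2)\<^sup>2 > 0" by simp
    then obtain N where N: "\<forall>n\<ge>N. \<forall>x\<in>topspace X. Re (form x (kaczmarz_error u n) (kaczmarz_error u
        n)) < (r / 2)\<^sup>2"
      using dini_to_0[where f = "\<lambda>n x. Re (form x (kaczmarz_error u n) (kaczmarz_error u n))", OF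
          compact_X continuous_form
          form_kaczmarz_error_antimono lim[rule_format]] by blast
    have "norm (kaczmarz_error u n) \<le> r / 2" if "n \<ge> N" for n
      using N that r by (subst norm_le_iff_form) (auto intro: less_imp_le)
    then show "\<exists>N. \<forall>n\<ge>N. norm (kaczmarz_error u n - 0) < r"
      using r by (intro exI[of _ N]) fastforce
  qed
qed

lemma effective_iff_kaczmarz_error: "effective smul ip e \<longleftrightarrow> (\<forall>u. kaczmarz_error u \<longlonglongrightarrow> 0)"
proof -
  have "effective_approx smul ip e u \<longlonglongrightarrow> u \<longleftrightarrow> kaczmarz_error u \<longlonglongrightarrow> 0" for u
  proof -
    have "kaczmarz_error u \<longlonglongrightarrow> 0 \<longleftrightarrow> (\<lambda>n. kaczmarz_error u (Suc n)) \<longlonglongrightarrow> 0"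
        by (rule filterlim_sequentially_Suc[symmetric])
    also have "\<dots> \<longleftrightarrow> effective_approx smul ip e u \<longlonglongrightarrow> u"
      unfolding kaczmarz_error_eq by (subst (1 2) tendsto_dist_iff)
          (simp add: dist_norm norm_minus_commute)
    finally show ?thesis ..
  qed
  then show ?thesis by (simp add: effective_def ip_e_self)
qed

text \<open>
  The error is A-linear in the initial vector and never longer than it, so it suffices to test a
  set that generates the module.
\<close>

lemma effective_iff_generators: "effective smul ip e \<longleftrightarrow> (\<forall>m. kaczmarz_error (e m) \<longlonglongrightarrow> 0)"
proof
  assume lim: "\<forall>m. kaczmarz_error (e m) \<longlonglongrightarrow> 0"
  have comb: "kaczmarz_error (\<Sum>n<N. smul (a n) (e n)) \<longlonglongrightarrow> 0" for N and a :: "nat \<Rightarrow> 'a"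
  proof -
    have "(\<lambda>k. smul (a n) (kaczmarz_error (e n) k)) \<longlonglongrightarrow> 0" for n
    proof (rule tendsto_norm_zero_cancel, rule tendsto_sandwich[OF _ _ tendsto_const])
      show "(\<lambda>k. norm (a n) * norm (kaczmarz_error (e n) k)) \<longlonglongrightarrow> 0"
        using lim by (intro tendsto_mult_right_zero tendsto_norm_zero) simp
    qed (simp_all add: norm_smul_le)
    then show ?thesis
      unfolding kaczmarz_error_sum[abs_def] kaczmarz_error_smul
          using tendsto_sum[of "{..<N}" "\<lambda>n k. smul (a n) (kaczmarz_error (e n) k)" "\<lambda>_. 0"] by simp
  qed
  have "kaczmarz_error u \<longlonglongrightarrow> 0" for u
  proof (rule LIMSEQ_I)
    fix r :: real assume r: "0 < r"
    have "u \<in> closure {y. \<exists>N a. y = (\<Sum>n<N. smul (a n) (e n))}"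
      using gen by (simp add: generates_def)
    then obtain y where "y \<in> {y. \<exists>N a. y = (\<Sum>n<N. smul (a n) (e n))}" "dist y u < r / 2"
      unfolding closure_approachable using r half_gt_zero by blast
    then obtain N a where near: "dist (\<Sum>n<N. smul (a n) (e n)) u < r / 2" by blast
    let ?y = "\<Sum>n<N. smul (a n) (e n)"
    obtain n0 where n0: "\<forall>n\<ge>n0. norm (kaczmarz_error ?y n) < r / 2"
      using LIMSEQ_D[OF comb, of "r / 2"] r by (metis diff_zero half_gt_zero)
    have "norm (kaczmarz_error u n) < r" if "n \<ge> n0" for n
    proof -
      have "kaczmarz_error u n = kaczmarz_error ?y n + kaczmarz_error (u - ?y) n"
          using kaczmarz_error_add[of ?y "u - ?y" n] by simp
      moreover have "norm (kaczmarz_error (u - ?y) n) < r / 2"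
        using norm_kaczmarz_error_le[of "u - ?y" n] near by (simp add: dist_norm norm_minus_commute)
      ultimately show ?thesis using n0 that norm_triangle_ineq[of "kaczmarz_error ?y n"
          "kaczmarz_error (u - ?y) n"] by force
    qed
    then show "\<exists>n0. \<forall>n\<ge>n0. norm (kaczmarz_error u n - 0) < r" by auto
  qed
  then show "effective smul ip e" by (simp add: effective_iff_kaczmarz_error)
qed (simp add: effective_iff_kaczmarz_error)

definition effective_at :: "'x \<Rightarrow> bool" where
  "effective_at x \<longleftrightarrow> (\<forall>m. (\<lambda>n. Re (form x (kaczmarz_error (e m) n) (kaczmarz_error (e m) n))) \<longlonglongrightarrow> 0)"

lemma effective_iff_effective_at: "effective smul ip e \<longleftrightarrow> (\<forall>x\<in>topspace X. effective_at x)"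
  unfolding effective_iff_generators kaczmarz_error_tendsto_0_iff effective_at_def by blast

lemma effective_at_iff:
  assumes x: "x \<in> topspace X" and \<mu>: "prob_measure_01 \<mu>" and fc: "\<And>n. fourier_coeff \<mu> n = gram x n"
    and d: "inverse_coeffs (gram x) d"
  shows "effective_at x \<longleftrightarrow> (\<forall>n. gram x (Suc n) = 0) \<or> (\<lambda>n. (cmod (d (Suc n)))\<^sup>2) sums 1"
proof -
  interpret measure_01 \<mu> by standard (rule \<mu>)
  have eq: "fourier_coeff \<mu> = gram x" using fc by auto
  show ?thesis
    unfolding effective_at_def form_kaczmarz_error_eq_residual[OF x measure_01_axioms fc]
    using residuals_tendsto_0_iff[of d] d by (simp add: eq)
qed

end


section \<open>Effective stationary sequences\<close>

theorem corollary4p1: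
  fixes smul :: "'a::{unital_cstar_algebra, comm_monoid_mult} \<Rightarrow> 'h::{banach, complex_vector} \<Rightarrow> 'h"
    and ip :: "'h \<Rightarrow> 'h \<Rightarrow> 'a"
    and X :: "'x topology"
    and \<phi> :: "'a \<Rightarrow> 'x \<Rightarrow> complex"
    and e :: "nat \<Rightarrow> 'h"
    and c :: "nat \<Rightarrow> 'a"
  assumes "hilbert_module smul ip"
    and "compact_space X" and "Hausdorff_space X"
    and "cstar_iso_CX X \<phi>"
    and "stationary smul e"
    and "generates smul e"
    and "ip (e 0) (e 0) = 1"
    and "c 0 = 1"
    and "\<And>n. n \<ge> 1 \<Longrightarrow> c n = - (\<Sum>j<n. c j * ip (e 0) (e (n - j)))"
  shows "(\<forall>x\<in>topspace X. \<exists>\<mu>. prob_measure_01 \<mu> \<and>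
            (\<forall>n. \<phi> (ip (e 0) (e n)) x = fourier_coeff \<mu> n)) \<and>
         (effective smul ip e \<longleftrightarrow>
           (\<forall>x\<in>topspace X. \<exists>\<mu>. (singular_measure_01 \<mu> \<or> \<mu> = lebesgue_01) \<and>
              (\<forall>n. \<phi> (ip (e 0) (e n)) x = fourier_coeff \<mu> n))) \<and>
         ((\<forall>x\<in>topspace X. \<exists>b. inner_function b \<and>
              (\<forall>z\<in>ball 0 1. (\<lambda>n. \<phi> (c (Suc n)) x * z ^ Suc n) sums b z)) \<longrightarrow>
           effective smul ip e)"
proof -
  interpret hilbert_module smul ip by fact
  interpret stationary_module X \<phi> smul ip e
    by unfold_locales fact+
  have inv: "inverse_coeffs (gram x) (\<lambda>n. \<phi> (c n) x)" if x: "x \<in> topspace X" for x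
    unfolding inverse_coeffs_def
  proof (intro conjI allI)
    show "\<phi> (c 0) x = 1" using \<open>c 0 = 1\<close> by (simp add: phi_one[OF x])
    fix n
    have "c (Suc n) = - (\<Sum>j\<le>n. c j * ip (e 0) (e (Suc n - j)))"
      using assms(9)[of "Suc n"] by (simp only: lessThan_Suc_atMost)
    then show "\<phi> (c (Suc n)) x = - (\<Sum>j\<le>n. \<phi> (c j) x * gram x (Suc n - j))"
      by (simp add: phi_minus[OF x] phi_sum[OF x] phi_mult[OF x] gram_def)
  qed
  have char: "effective_at x \<longleftrightarrow>
      (\<exists>\<mu>. (singular_measure_01 \<mu> \<or> \<mu> = lebesgue_01) \<and> (\<forall>n. gram x n = fourier_coeff \<mu> n))"
    if x: "x \<in> topspace X" for x
  proof
    assume eff: "effective_at x"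
    obtain \<mu> where \<mu>: "prob_measure_01 \<mu>" and fc: "\<And>n. fourier_coeff \<mu> n = gram x n"
      using gram_measure[OF x] by blast
    interpret measure_01 \<mu> by standard (rule \<mu>)
    have eq: "fourier_coeff \<mu> = gram x" using fc by auto
    from effective_at_iff[OF x \<mu> fc inv[OF x]] eff
    consider "\<forall>n. gram x (Suc n) = 0" | "(\<lambda>n. (cmod (\<phi> (c (Suc n)) x))\<^sup>2) sums 1" by blast
    then show "\<exists>\<mu>. (singular_measure_01 \<mu> \<or> \<mu> = lebesgue_01) \<and> (\<forall>n. gram x n = fourier_coeff \<mu> n)"
    proof cases
      case 1
      have "gram x n = fourier_coeff lebesgue_01 n" for n
        using 1 gram_0[OF x] by (cases n) (simp_all add: fourier_coeff_lebesgue)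
      then show ?thesis by blast
    next
      case 2
      have "mutually_singular \<mu> lebesgue_01"
        by (rule singular_if_sum_coeffs_eq_1[OF _ 2]) (use inv[OF x] in \<open>simp add: eq\<close>)
      then show ?thesis using \<mu> fc by (intro exI[of _ \<mu>]) (simp add: singular_measure_01_def)
    qed
  next
    assume "\<exists>\<mu>. (singular_measure_01 \<mu> \<or> \<mu> = lebesgue_01) \<and> (\<forall>n. gram x n = fourier_coeff \<mu> n)"
    then obtain \<mu> where \<mu>: "singular_measure_01 \<mu> \<or> \<mu> = lebesgue_01"
      and "\<forall>n. gram x n = fourier_coeff \<mu> n" by blast
    then have fc: "fourier_coeff \<mu> n = gram x n" for n by simp
    have eq: "fourier_coeff \<mu> = gram x" using fc by auto
    from \<mu> show "effective_at x"
    proof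
      assume sing: "singular_measure_01 \<mu>"
      then have p: "prob_measure_01 \<mu>" by (simp add: singular_measure_01_def)
      interpret measure_01 \<mu> by standard (rule p)
      have "(\<lambda>n. (cmod (\<phi> (c (Suc n)) x))\<^sup>2) sums 1"
        using sing inv[OF x] by (intro sum_coeffs_eq_1_if_singular) (simp_all add: eq
            singular_measure_01_def)
      then show ?thesis using effective_at_iff[OF x p fc inv[OF x]] by simp
    next
      assume "\<mu> = lebesgue_01"
      then have "\<forall>n. gram x (Suc n) = 0" using fc by (auto simp: fourier_coeff_lebesgue simp flip: fc)
      then show ?thesis
        using effective_at_iff[OF x _ fc inv[OF x]] prob_measure_01_lebesgue \<open>\<mu> = lebesgue_01\<close> by simp
    qed
  qed
  have inner: "effective_at x" if x: "x \<in> topspace X"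
    and b: "inner_function b" "\<forall>z\<in>ball 0 1. (\<lambda>n. \<phi> (c (Suc n)) x * z ^ Suc n) sums b z" for x b
  proof -
    obtain \<mu> where \<mu>: "prob_measure_01 \<mu>" and fc: "\<And>n. fourier_coeff \<mu> n = gram x n"
      using gram_measure[OF x] by blast
    define d where "d n = (if n = 0 then 0 else \<phi> (c n) x)" for n
    have "\<forall>z\<in>ball 0 1. (\<lambda>n. d n * z ^ n) sums b z"
    proof
      fix z :: complex assume "z \<in> ball 0 1"
      with b(2) have "(\<lambda>n. d (Suc n) * z ^ Suc n) sums b z" by (simp add: d_def)
      then show "(\<lambda>n. d n * z ^ n) sums b z"
        by (subst (asm) sums_Suc_iff) (simp add: d_def)
    qed
    then have "(\<lambda>n. (cmod (d n))\<^sup>2) sums 1" by (rule inner_function_coeffs[OF b(1)])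
    then have "(\<lambda>n. (cmod (d (Suc n)))\<^sup>2) sums 1"
      by (subst sums_Suc_iff) (simp add: d_def)
    then show ?thesis using effective_at_iff[OF x \<mu> fc inv[OF x]] by (simp add: d_def)
  qed
  show ?thesis
    unfolding effective_iff_effective_at gram_def[symmetric]
  proof (intro conjI)
    show "\<forall>x\<in>topspace X. \<exists>\<mu>. prob_measure_01 \<mu> \<and> (\<forall>n. gram x n = fourier_coeff \<mu> n)"
    proof
      fix x assume "x \<in> topspace X"
      then obtain \<mu> where "prob_measure_01 \<mu>" "\<And>n. fourier_coeff \<mu> n = gram x n"
        using gram_measure by blast
      then show "\<exists>\<mu>. prob_measure_01 \<mu> \<and> (\<forall>n. gram x n = fourier_coeff \<mu> n)" by auto
    qed
    show "(\<forall>x\<in>topspace X. effective_at x) \<longleftrightarrow> (\<forall>x\<in>topspace X.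
        \<exists>\<mu>. (singular_measure_01 \<mu> \<or> \<mu> = lebesgue_01) \<and> (\<forall>n. gram x n = fourier_coeff \<mu> n))"
      using char by blast
    show "(\<forall>x\<in>topspace X. \<exists>b. inner_function b \<and>
        (\<forall>z\<in>ball 0 1. (\<lambda>n. \<phi> (c (Suc n)) x * z ^ Suc n) sums b z)) \<longrightarrow> (\<forall>x\<in>topspace X. effective_at x)"
      using inner by blast
  qed
qed

end
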